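(* Let $\mathscr{A}$ be a set that is at most countable, and let $X\subseteq\mathscr{A}^\omega$ be a subshift over $\mathscr{A}$ with a safe symbol (in particular, this covers the case where $\mathscr{A}=\{0,1,\ldots,n\}$ or $\mathscr{A}=\omega$ and $X$ is a hereditary shift) and with more than one shift-invariant Borel probability measure. Let $G_\mu$ denote the set of generic points in $X$ of a measure $\mu$, let $I(X)$ be the irregular set and $Q(X)=X\setminus I(X)$ the quasi-regular set. If $\mu$ is a shift-invariant Borel probability measure on $X$ such that $G_\mu\neq\emptyset$ and $B\subseteq X$ is a Borel set satisfying $G_\mu\subseteq B\subseteq Q(X)$, then $B$ is $\mathbf{\Pi}^0_3$-hard. In particular, $B$ is $\mathbf{\Pi}^0_3$-complete provided that $B$ is a $\mathbf{\Pi}^0_3$-set. Hence, for every shift-invariant Borel probability measure $\mu$ on $X$, the set $G_\mu$ is either empty or $\mathbf{\Pi}^0_3$-complete. In particular, $G_\mu$ is $\mathbf{\Pi}^0_3$-complete for every ergodic shift-invariant Borel probability measure $\mu$ on $X$. Furthermore, $Q(X)$ is a $\mathbf{\Pi}^0_3$-complete set and $I(X)$ is a $\mathbf{\Sigma}^0_3$-complete set.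
   Context: $\omega=\{0,1,2,\ldots\}$. $\mathscr{A}$ carries the discrete topology and $\mathscr{A}^\omega$ the product topology; $\sigma$ is the shift, $\sigma(x)_n=x_{n+1}$. A subshift over $\mathscr{A}$ is a nonempty closed set $X\subseteq\mathscr{A}^\omega$ with $\sigma(X)\subseteq X$ (not necessarily compact). A symbol $\gamma\in\mathscr{A}$ is a safe symbol for $X$ if for every $x\in X$ and $k\ge0$ the point $y$ with $y_k=\gamma$ and $y_n=x_n$ for $n\ne k$ belongs to $X$. When $\mathscr{A}=\{0,1,\ldots,n\}$ or $\mathscr{A}=\omega$, the subshift $X$ is hereditary if $x\in X$, $y\in\mathscr{A}^\omega$ and $y\le x$ coordinatewise imply $y\in X$ (then $0$ is a safe symbol). A block $w=w_1\ldots w_n$ over $\mathscr{A}$ appears in $x\in\mathscr{A}^\omega$ at position $\ell\in\omega$ if $x_{\ell+i-1}=w_i$ for $1\le i\le n$; $e(w,x,N)$ is the number of positions $\ell<N$ at which $w$ appears in $x$. The language $\mathscr{L}(X)$ is the set of all nonempty finite blocks that appear in some $x\in X$. $[w]$ is the set of $z\in\mathscr{A}^\omega$ with $z_0=w_1,\ldots,z_{n-1}=w_n$. A Borel probability measure $\mu$ on $\mathscr{A}^\omega$ is shift-invariant if $\mu(A)=\mu(\sigma^{-1}(A))$ for all Borel $A$; it is a measure on $X$ if $\mu(X)=1$; it is ergodic if $\sigma^{-1}(A)=A$ implies $\mu(A)\in\{0,1\}$ for Borel $A$. A point $x\in X$ is generic for $\mu$ if $\lim_{N\to\infty} e(w,x,N)/N=\mu([w])$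 for every nonempty finite block $w$ over $\mathscr{A}$. The irregular set $I(X)$ is the set of $x\in X$ for which there is $w\in\mathscr{L}(X)$ with $\liminf_{N\to\infty} e(w,x,N)/N<\limsup_{N\to\infty} e(w,x,N)/N$. In the Polish space $X$: $\mathbf{\Sigma}^0_1$ = open sets, $\mathbf{\Pi}^0_k$ = complements of $\mathbf{\Sigma}^0_k$ sets, $\mathbf{\Sigma}^0_{k+1}$ = countable unions of $\mathbf{\Pi}^0_k$ sets. A set is $\mathbf{\Pi}^0_3$-hard if it is not $\mathbf{\Sigma}^0_3$; it is $\mathbf{\Pi}^0_3$-complete if it is in $\mathbf{\Pi}^0_3\setminus\mathbf{\Sigma}^0_3$, and $\mathbf{\Sigma}^0_3$-complete if it is in $\mathbf{\Sigma}^0_3\setminus\mathbf{\Pi}^0_3$. *)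

theory Defs
  imports "HOL-Probability.Probability"
begin

text \<open>The alphabet is a set \<open>A\<close> of elements of an arbitrary type; the one-sided sequences over
  it are the functions from \<open>nat\<close> with values in \<open>A\<close>.\<close>

definition seqs :: "'a set \<Rightarrow> (nat \<Rightarrow> 'a) set" where
  "seqs A = {x. \<forall>n. x n \<in> A}"

definition seq_topology :: "'a set \<Rightarrow> (nat \<Rightarrow> 'a) topology" where
  "seq_topology A = product_topology (\<lambda>_. discrete_topology A) UNIV"

lemma topspace_seq_topology [simp]: "topspace (seq_topology A) = seqs A"
  by (auto simp: seq_topology_def seqs_def)

definition shift :: "(nat \<Rightarrow> 'a) \<Rightarrow> nat \<Rightarrow> 'a" where
  "shift x = (\<lambda>n. x (Suc n))"

definition subshift :: "'a set \<Rightarrow> (nat \<Rightarrow> 'a) set \<Rightarrow> bool" where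
  "subshift A X \<longleftrightarrow> X \<noteq> {} \<and> closedin (seq_topology A) X \<and> shift ` X \<subseteq> X"

definition safe_symbol :: "'a set \<Rightarrow> (nat \<Rightarrow> 'a) set \<Rightarrow> 'a \<Rightarrow> bool" where
  "safe_symbol A X \<gamma> \<longleftrightarrow> \<gamma> \<in> A \<and> (\<forall>x\<in>X. \<forall>k. x(k := \<gamma>) \<in> X)"

definition hereditary :: "nat set \<Rightarrow> (nat \<Rightarrow> nat) set \<Rightarrow> bool" where
  "hereditary A X \<longleftrightarrow> (\<forall>x\<in>X. \<forall>y\<in>seqs A. (\<forall>n. y n \<le> x n) \<longrightarrow> y \<in> X)"

text \<open>Blocks are lists, so that the letter \<open>w\<^sub>i\<close> (counted from 1) is \<open>w ! (i - 1)\<close>.\<close>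

definition appears_at :: "'a list \<Rightarrow> (nat \<Rightarrow> 'a) \<Rightarrow> nat \<Rightarrow> bool" where
  "appears_at w x l \<longleftrightarrow> (\<forall>i<length w. x (l + i) = w ! i)"

definition occurrences :: "'a list \<Rightarrow> (nat \<Rightarrow> 'a) \<Rightarrow> nat \<Rightarrow> nat" where
  "occurrences w x N = card {l. l < N \<and> appears_at w x l}"

definition frequency :: "'a list \<Rightarrow> (nat \<Rightarrow> 'a) \<Rightarrow> nat \<Rightarrow> real" where
  "frequency w x N = real (occurrences w x N) / real N"

definition language :: "(nat \<Rightarrow> 'a) set \<Rightarrow> 'a list set" where
  "language X = {w. w \<noteq> [] \<and> (\<exists>x\<in>X. \<exists>l. appears_at w x l)}"

definition cylinder :: "'a set \<Rightarrow> 'a list \<Rightarrow> (nat \<Rightarrow> 'a) set" where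
  "cylinder A w = {z \<in> seqs A. \<forall>i<length w. z i = w ! i}"

definition seq_borel :: "'a set \<Rightarrow> (nat \<Rightarrow> 'a) measure" where
  "seq_borel A = sigma (seqs A) {U. openin (seq_topology A) U}"

definition invariant_measure :: "'a set \<Rightarrow> (nat \<Rightarrow> 'a) measure \<Rightarrow> bool" where
  "invariant_measure A \<mu> \<longleftrightarrow>
     prob_space \<mu> \<and> sets \<mu> = sets (seq_borel A) \<and>
     (\<forall>S\<in>sets (seq_borel A). measure \<mu> S = measure \<mu> (shift -` S \<inter> seqs A))"

definition invariant_measure_on :: "'a set \<Rightarrow> (nat \<Rightarrow> 'a) set \<Rightarrow> (nat \<Rightarrow> 'a) measure \<Rightarrow> bool" where
  "invariant_measure_on A X \<mu> \<longleftrightarrow> invariant_measure A \<mu> \<and> measure \<mu> X = 1"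

definition ergodic :: "'a set \<Rightarrow> (nat \<Rightarrow> 'a) measure \<Rightarrow> bool" where
  "ergodic A \<mu> \<longleftrightarrow>
     (\<forall>S\<in>sets (seq_borel A). shift -` S \<inter> seqs A = S \<longrightarrow> measure \<mu> S \<in> {0, 1})"

definition generic_points :: "'a set \<Rightarrow> (nat \<Rightarrow> 'a) set \<Rightarrow> (nat \<Rightarrow> 'a) measure \<Rightarrow> (nat \<Rightarrow> 'a) set" where
  "generic_points A X \<mu> =
     {x \<in> X. \<forall>w. w \<noteq> [] \<and> set w \<subseteq> A \<longrightarrow> frequency w x \<longlonglongrightarrow> measure \<mu> (cylinder A w)}"

definition irregular_set :: "(nat \<Rightarrow> 'a) set \<Rightarrow> (nat \<Rightarrow> 'a) set" where
  "irregular_set X =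
     {x \<in> X. \<exists>w\<in>language X. liminf (\<lambda>N. ereal (frequency w x N)) < limsup (\<lambda>N. ereal (frequency w x N))}"

definition quasi_regular_set :: "(nat \<Rightarrow> 'a) set \<Rightarrow> (nat \<Rightarrow> 'a) set" where
  "quasi_regular_set X = X - irregular_set X"

text \<open>The hierarchy starts at level 1; level 0 is a dummy value.\<close>

fun borel_Sigma :: "'b topology \<Rightarrow> nat \<Rightarrow> 'b set set" where
  "borel_Sigma T 0 = {}"
| "borel_Sigma T (Suc 0) = {U. openin T U}"
| "borel_Sigma T (Suc (Suc k)) =
     {\<Union>(range P) | P :: nat \<Rightarrow> 'b set. \<forall>n. P n \<in> (\<lambda>S. topspace T - S) ` borel_Sigma T (Suc k)}"

definition borel_Pi :: "'b topology \<Rightarrow> nat \<Rightarrow> 'b set set" where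
  "borel_Pi T k = (\<lambda>S. topspace T - S) ` borel_Sigma T k"

definition Pi3_hard :: "'b topology \<Rightarrow> 'b set \<Rightarrow> bool" where
  "Pi3_hard T B \<longleftrightarrow> B \<notin> borel_Sigma T 3"

definition Pi3_complete :: "'b topology \<Rightarrow> 'b set \<Rightarrow> bool" where
  "Pi3_complete T B \<longleftrightarrow> B \<in> borel_Pi T 3 - borel_Sigma T 3"

definition Sigma3_complete :: "'b topology \<Rightarrow> 'b set \<Rightarrow> bool" where
  "Sigma3_complete T B \<longleftrightarrow> B \<in> borel_Sigma T 3 - borel_Pi T 3"

end

theory Submission
  imports Defs
begin

text \<open>
  The set of \<open>z \<in> \<omega>\<^sup>\<omega>\<close> with \<open>z n \<rightarrow> \<infinity>\<close> is not \<open>\<Sigma>\<^sub>3\<close>, and it is reduced continuously to \<open>B\<close>.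
  Take points \<open>u, v \<in> X\<close>, one of them the constant sequence of the safe symbol, in which some symbol
  \<open>a\<close> has different frequencies, and copy \<open>v\<close> over \<open>u\<close> on a sparse sequence of windows, the \<open>n\<close>-th of
  relative length \<open>1 / (z n + 1)\<close>. If \<open>z n \<rightarrow> \<infinity>\<close>, the windows have density 0 and all block
  frequencies of \<open>u\<close> are kept. If \<open>z\<close> takes some value infinitely often, those windows
  shift the frequency of \<open>a\<close> by a fixed amount and it diverges.

  If \<open>\<mu>\<close> charges a symbol other than the safe one, let \<open>u\<close> be generic for \<open>\<mu>\<close> and \<open>v\<close> constant.
  Otherwise \<open>\<mu>\<close> is the point mass at the constant sequence \<open>u\<close>, another invariant measure
  charges some other symbol \<open>a\<close>, and Birkhoff's theorem provides a point \<open>v\<close> in which \<open>a\<close> has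
  a positive frequency. The ergodic theorem also shows that ergodic measures have generic points.
\<close>

subsection \<open>The Borel hierarchy on a subshift\<close>

text \<open>A basic open set of the product restricts finitely many coordinates, all below some
  \<open>n\<close>, and agreement with \<open>x\<close> below \<open>n\<close> is itself a basic
  open condition. All topological arguments below go through this prefix criterion.\<close>

lemma openin_seq_topology_iff:
  "openin (seq_topology A) U \<longleftrightarrow>
     U \<subseteq> seqs A \<and> (\<forall>x\<in>U. \<exists>n. \<forall>y\<in>seqs A. (\<forall>i<n. y i = x i) \<longrightarrow> y \<in> U)"
    (is "?L \<longleftrightarrow> ?R")
proof
  assume L: ?L
  have "U \<subseteq> seqs A"
    using openin_subset[OF L] by simp
  moreover have "\<exists>n. \<forall>y\<in>seqs A. (\<forall>i<n. y i = x i) \<longrightarrow> y \<in> U" if x: "x \<in> U" for x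
  proof -
    obtain V where "finite {i \<in> UNIV. V i \<noteq> topspace (discrete_topology A)}"
        "\<forall>i\<in>UNIV. openin (discrete_topology A) (V i)" and V: "x \<in> PiE UNIV V" "PiE UNIV V \<subseteq> U"
      using L[unfolded seq_topology_def openin_product_topology_alt, THEN bspec, OF x] by blast
    then have fin: "finite {i. V i \<noteq> A}" by simp
    obtain n where n: "\<And>i. i \<in> {i. V i \<noteq> A} \<Longrightarrow> i < n"
      using fin[unfolded finite_nat_set_iff_bounded] by blast
    have "y \<in> U" if "y \<in> seqs A" "\<forall>i<n. y i = x i" for y
    proof -
      have "y i \<in> V i" for i
        using V(1) n[of i] that by (cases "i < n") (auto simp: seqs_def PiE_iff)
      then show ?thesis using V(2) by (auto simp: PiE_iff)
    qed
    then show ?thesis by blast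
  qed
  ultimately show ?R by blast
next
  assume R: ?R
  show ?L
    unfolding seq_topology_def openin_product_topology_alt
  proof
    fix x assume x: "x \<in> U"
    obtain n where n: "\<And>y. y \<in> seqs A \<Longrightarrow> \<forall>i<n. y i = x i \<Longrightarrow> y \<in> U"
      using R x by blast
    let ?V = "\<lambda>i. if i < n then {x i} else A"
    have xA: "x i \<in> A" for i using R x by (auto simp: seqs_def)
    have "finite {i. ?V i \<noteq> A}"
      by (rule finite_subset[of _ "{..<n}"]) auto
    moreover have "PiE UNIV ?V \<subseteq> U"
    proof
      fix y assume "y \<in> PiE UNIV ?V"
      then have "y i \<in> ?V i" for i by (auto simp: PiE_iff)
      then have y: "if i < n then y i = x i else y i \<in> A" for i
        by (cases "i < n") (use \<open>y i \<in> ?V i\<close> in auto)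
      have "y i \<in> A" for i
        using y[of i] xA[of i] by (cases "i < n") auto
      then show "y \<in> U" using y by (intro n) (auto simp: seqs_def split: if_splits)
    qed
    ultimately show "\<exists>V. finite {i \<in> UNIV. V i \<noteq> topspace (discrete_topology A)} \<and>
        (\<forall>i\<in>UNIV. openin (discrete_topology A) (V i)) \<and> x \<in> PiE UNIV V \<and> PiE UNIV V \<subseteq> U"
      using xA by (intro exI[of _ ?V]) (auto simp: PiE_iff)
  qed
qed

lemma openin_subshift_iff:
  assumes "X \<subseteq> seqs A"
  shows "openin (subtopology (seq_topology A) X) U \<longleftrightarrow>
     U \<subseteq> X \<and> (\<forall>x\<in>U. \<exists>n. \<forall>y\<in>X. (\<forall>i<n. y i = x i) \<longrightarrow> y \<in> U)"
    (is "?L \<longleftrightarrow> ?R")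
proof
  assume ?L
  then obtain V where V: "openin (seq_topology A) V" and U: "U = V \<inter> X"
    unfolding openin_subtopology by blast
  show ?R
  proof (intro conjI ballI)
    fix x assume "x \<in> U"
    then obtain n where "\<forall>y\<in>seqs A. (\<forall>i<n. y i = x i) \<longrightarrow> y \<in> V"
      using V U unfolding openin_seq_topology_iff by blast
    then show "\<exists>n. \<forall>y\<in>X. (\<forall>i<n. y i = x i) \<longrightarrow> y \<in> U"
      using assms U by (intro exI[of _ n]) auto
  qed (use U in blast)
next
  assume R: ?R
  \<comment> \<open>The union of all cylinders of the full sequence space whose trace on
    \<open>X\<close> lies in \<open>U\<close>.\<close>
  let ?V = "{y \<in> seqs A. \<exists>x\<in>U. \<exists>n. (\<forall>z\<in>X. (\<forall>i<n. z i = x i) \<longrightarrow> z \<in> U) \<and> (\<forall>i<n. y i = x i)}"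
  have "openin (seq_topology A) ?V"
    unfolding openin_seq_topology_iff
  proof (intro conjI ballI)
    fix y assume "y \<in> ?V"
    then obtain x n where xn: "x \<in> U" "\<forall>z\<in>X. (\<forall>i<n. z i = x i) \<longrightarrow> z \<in> U" "\<forall>i<n. y i = x i"
      by blast
    show "\<exists>n. \<forall>ya\<in>seqs A. (\<forall>i<n. ya i = y i) \<longrightarrow> ya \<in> ?V"
      using xn by (intro exI[of _ n]) auto
  qed blast
  moreover have "U = ?V \<inter> X"
  proof
    show "U \<subseteq> ?V \<inter> X"
    proof
      fix x assume x: "x \<in> U"
      then obtain n where "\<forall>z\<in>X. (\<forall>i<n. z i = x i) \<longrightarrow> z \<in> U"
        using R by blast
      then show "x \<in> ?V \<inter> X"
        using x R assms by blast
    qed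
  qed blast
  ultimately show ?L unfolding openin_subtopology by blast
qed

text \<open>A condition on the first \<open>n\<close> coordinates is locally constant, so its
  negation is open. This will be applied to inequalities between frequencies at fixed times.\<close>

lemma closedin_finite_coordinates:
  assumes "X \<subseteq> seqs A" and "\<And>x y. (\<And>i. i < n \<Longrightarrow> x i = y i) \<Longrightarrow> P x \<Longrightarrow> P y"
  shows "closedin (subtopology (seq_topology A) X) {x \<in> X. P x}"
proof -
  have "openin (subtopology (seq_topology A) X) (X - {x \<in> X. P x})"
    unfolding openin_subshift_iff[OF assms(1)]
  proof (intro conjI ballI exI[of _ n] impI)
    fix x y assume "x \<in> X - {x \<in> X. P x}" "y \<in> X" "\<forall>i<n. y i = x i"
    then show "y \<in> X - {x \<in> X. P x}"
      using assms(2)[of y x] by auto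
  qed auto
  then show ?thesis
    using assms(1) by (auto simp: closedin_def Int_absorb1)
qed

lemma borel_Sigma_subset_topspace: "S \<in> borel_Sigma T k \<Longrightarrow> S \<subseteq> topspace T"
proof (induction T k arbitrary: S rule: borel_Sigma.induct)
  case (3 T k)
  then show ?case by (fastforce simp: image_iff)
qed (auto dest: openin_subset)

lemma borel_Sigma_2_iff:
  "B \<in> borel_Sigma T 2 \<longleftrightarrow> (\<exists>C :: nat \<Rightarrow> _. (\<forall>k. closedin T (C k)) \<and> B = (\<Union>k. C k))"
proof -
  have "(\<exists>U. openin T U \<and> S = topspace T - U) \<longleftrightarrow> closedin T S" for S
    by (metis closedin_def double_diff openin_closedin_eq order_refl)
  then show ?thesis
    by (simp add: numeral_2_eq_2 image_iff Bex_def) blast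
qed

lemma borel_Sigma_3_iff_Sigma_2:
  "B \<in> borel_Sigma T 3 \<longleftrightarrow>
     (\<exists>S :: nat \<Rightarrow> _. (\<forall>n. S n \<in> borel_Sigma T 2) \<and> B = (\<Union>n. topspace T - S n))"
proof -
  have *: "borel_Sigma T 3 =
      {\<Union>(range P) | P :: nat \<Rightarrow> _. \<forall>n. P n \<in> (\<lambda>S. topspace T - S) ` borel_Sigma T 2}"
    unfolding numeral_3_eq_3 numeral_2_eq_2 by (rule borel_Sigma.simps(3))
  show ?thesis
  proof
    assume "B \<in> borel_Sigma T 3"
    then obtain P :: "nat \<Rightarrow> _" where B: "B = \<Union>(range P)"
        and P: "\<forall>n. P n \<in> (\<lambda>S. topspace T - S) ` borel_Sigma T 2"
      unfolding * by blast
    have "\<forall>n. \<exists>S. S \<in> borel_Sigma T 2 \<and> P n = topspace T - S"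
      using P by blast
    then obtain S where "\<forall>n. S n \<in> borel_Sigma T 2 \<and> P n = topspace T - S n"
      using choice[of "\<lambda>n S. S \<in> borel_Sigma T 2 \<and> P n = topspace T - S"] by blast
    then show "\<exists>S :: nat \<Rightarrow> _. (\<forall>n. S n \<in> borel_Sigma T 2) \<and> B = (\<Union>n. topspace T - S n)"
      using B by (intro exI[of _ S]) simp
  next
    assume "\<exists>S :: nat \<Rightarrow> _. (\<forall>n. S n \<in> borel_Sigma T 2) \<and> B = (\<Union>n. topspace T - S n)"
    then show "B \<in> borel_Sigma T 3"
      unfolding * by blast
  qed
qed

text \<open>Removes the nested complements of the recursive definition: a
  \<open>\<Sigma>\<^sub>3\<close> set is a countable union of G-delta sets. The Baire argument and
  the upper bounds both start from this form.\<close>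

lemma borel_Sigma_3_iff:
  "B \<in> borel_Sigma T 3 \<longleftrightarrow>
     (\<exists>U :: nat \<Rightarrow> nat \<Rightarrow> _. (\<forall>j k. openin T (U j k)) \<and> B = (\<Union>j. \<Inter>k. U j k))"
proof
  assume "B \<in> borel_Sigma T 3"
  then obtain S :: "nat \<Rightarrow> _" where S: "\<forall>n. S n \<in> borel_Sigma T 2"
      and B: "B = (\<Union>n. topspace T - S n)"
    unfolding borel_Sigma_3_iff_Sigma_2 by blast
  obtain C :: "nat \<Rightarrow> nat \<Rightarrow> _" where C: "\<forall>n. (\<forall>k. closedin T (C n k)) \<and> S n = (\<Union>k. C n k)"
    using choice[OF S[unfolded borel_Sigma_2_iff]] by blast
  show "\<exists>U :: nat \<Rightarrow> nat \<Rightarrow> _. (\<forall>j k. openin T (U j k)) \<and> B = (\<Union>j. \<Inter>k. U j k)"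
    using C unfolding B by (intro exI[of _ "\<lambda>j k. topspace T - C j k"]) auto
next
  assume "\<exists>U :: nat \<Rightarrow> nat \<Rightarrow> _. (\<forall>j k. openin T (U j k)) \<and> B = (\<Union>j. \<Inter>k. U j k)"
  then obtain U :: "nat \<Rightarrow> nat \<Rightarrow> _" where U: "\<And>j k. openin T (U j k)" and B: "B = (\<Union>j. \<Inter>k. U j k)"
    by blast
  have sub: "U j k \<subseteq> topspace T" for j k
    by (rule openin_subset[OF U])
  have "(\<Union>k. topspace T - U j k) \<in> borel_Sigma T 2" for j
    unfolding borel_Sigma_2_iff using U by (intro exI[of _ "\<lambda>k. topspace T - U j k"]) auto
  moreover have "B = (\<Union>j. topspace T - (\<Union>k. topspace T - U j k))"
    using sub unfolding B by blast
  ultimately show "B \<in> borel_Sigma T 3"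
    unfolding borel_Sigma_3_iff_Sigma_2
    by (intro exI[of _ "\<lambda>j. \<Union>k. topspace T - U j k"]) blast
qed

text \<open>The shape of a convergence statement: for each of countably many words and tolerances
  \<open>i\<close> there is a starting time \<open>k\<close> from which a closed condition holds.
  The index set must be nonempty, since an empty intersection would be the whole type instead of a
  subset of the space.\<close>

lemma countable_INT_UN_closedin_in_Pi3:
  fixes C :: "'i \<Rightarrow> nat \<Rightarrow> 'b set"
  assumes "countable I" "I \<noteq> {}" and C: "\<And>i k. i \<in> I \<Longrightarrow> closedin T (C i k)"
  shows "(\<Inter>i\<in>I. \<Union>k. C i k) \<in> borel_Pi T 3"
proof -
  define e where "e = from_nat_into I"
  have e: "range e = I"
    unfolding e_def using assms by (simp add: range_from_nat_into)
  have sub: "C (e j) k \<subseteq> topspace T" for j k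
    using C e by (meson closedin_subset rangeI)
  have "(\<Inter>i\<in>I. \<Union>k. C i k) = (\<Inter>j. \<Union>k. C (e j) k)"
    using e by blast
  also have "\<dots> = topspace T - (\<Union>j. \<Inter>k. topspace T - C (e j) k)"
    using sub by blast
  finally have "(\<Inter>i\<in>I. \<Union>k. C i k) = topspace T - (\<Union>j. \<Inter>k. topspace T - C (e j) k)" .
  moreover have "(\<Union>j. \<Inter>k. topspace T - C (e j) k) \<in> borel_Sigma T 3"
    unfolding borel_Sigma_3_iff using C e
    by (intro exI[of _ "\<lambda>j k. topspace T - C (e j) k"]) auto
  ultimately show ?thesis unfolding borel_Pi_def by blast
qed

section \<open>Hardness from Baire category\<close>

lemma fusion_limit:
  fixes z :: "nat \<Rightarrow> nat \<Rightarrow> 'a" and n :: "nat \<Rightarrow> nat"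
  assumes "\<And>k. n k < n (Suc k)" and "\<And>k i. i < n k \<Longrightarrow> z (Suc k) i = z k i"
  obtains y where "\<And>k i. i < n k \<Longrightarrow> y i = z k i"
proof -
  have mono: "strict_mono n" using assms(1) by (simp add: strict_mono_Suc_iff)
  have *: "z (k + d) i = z k i" if "i < n k" for i k d
  proof (induction d)
    case (Suc d)
    have "n k \<le> n (k + d)" using mono by (simp add: strict_mono_less_eq)
    then show ?case using Suc assms(2)[of i "k + d"] that by simp
  qed simp
  \<comment> \<open>Stage \<open>k\<close> fixes the coordinates below \<open>n k\<close> for good.
    Since \<open>i < n (Suc i)\<close>, stage \<open>Suc i\<close> already has the final value at
    \<open>i\<close>, so the diagonal is the limit.\<close>
  have "z (Suc i) i = z k i" if "i < n k" for i k
  proof (cases "Suc i \<le> k")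
    case True
    have "i < n (Suc i)"
      using strict_mono_imp_increasing[OF mono, of "Suc i"] by simp
    then show ?thesis using *[of i "Suc i" "k - Suc i"] True by simp
  next
    case False
    then show ?thesis using *[of i k "Suc i - k"] that by simp
  qed
  then show thesis using that[of "\<lambda>i. z (Suc i) i"] by blast
qed

text \<open>A direct Baire category argument. A \<open>G\<^sub>\<delta>\<close> set that is dense in the closed set of all
  extensions of a finite string by values at least \<open>m\<close> contains a sequence taking the value \<open>m\<close>
  infinitely often. So each of the countably many \<open>G\<^sub>\<delta>\<close> pieces of a \<open>\<Sigma>\<^sub>3\<close> set of sequences
  tending to infinity is avoided after a suitable further extension by values at least \<open>m\<close>, and
  letting \<open>m\<close> grow yields a sequence that tends to infinity and avoids all pieces.\<close>

lemma Pi3_hard_if_reduces_tendsto_infinity: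
  fixes F :: "(nat \<Rightarrow> nat) \<Rightarrow> 'b"
  assumes cont: "\<And>U z. openin T U \<Longrightarrow> F z \<in> U \<Longrightarrow> \<exists>n. \<forall>z'. (\<forall>i<n. z' i = z i) \<longrightarrow> F z' \<in> U"
    and reduces: "\<And>z. F z \<in> B \<longleftrightarrow> filterlim z at_top sequentially"
  shows "Pi3_hard T B"
  unfolding Pi3_hard_def
proof
  assume "B \<in> borel_Sigma T 3"
  then obtain U :: "nat \<Rightarrow> nat \<Rightarrow> _" where opn: "\<And>j k. openin T (U j k)" and B: "B = (\<Union>j. \<Inter>k. U j k)"
    unfolding borel_Sigma_3_iff by blast
  define E where "E z n m = {y :: nat \<Rightarrow> nat. (\<forall>i<n. y i = z i) \<and> (\<forall>i\<ge>n. m \<le> y i)}" for z n m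
  have avoid: "\<exists>z' n'. z' \<in> E z n m \<and> n < n' \<and> (\<forall>y\<in>E z' n' m. F y \<notin> (\<Inter>k. U j k))" for j z n m
  proof (rule ccontr)
    assume "\<not> ?thesis"
    \<comment> \<open>The negated claim says that the preimage of the \<open>j\<close>-th G-delta
      set is dense in \<open>E z n m\<close>.\<close>
    then have dense: "\<exists>y\<in>E z' n' m. F y \<in> (\<Inter>k. U j k)" if "z' \<in> E z n m" "n < n'" for z' n'
      using that by blast
    \<comment> \<open>A state consists of a sequence and the length of its frozen prefix. Step
      \<open>k\<close> freezes a longer prefix that forces membership in \<open>U j k\<close> and
      contains one more value \<open>m\<close>.\<close>
    define P where "P p \<longleftrightarrow> fst p \<in> E z n m \<and> n < snd p" for p :: "(nat \<Rightarrow> nat) \<times> nat"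
    define R where "R k p q \<longleftrightarrow> snd p < snd q \<and> (\<forall>i<snd p. fst q i = fst p i) \<and>
      (\<exists>i\<ge>snd p. i < snd q \<and> fst q i = m) \<and> (\<forall>y. (\<forall>i<snd q. y i = fst q i) \<longrightarrow> F y \<in> U j k)"
      for k and p q :: "(nat \<Rightarrow> nat) \<times> nat"
    have "\<exists>p. \<forall>k. P (p k) \<and> R k (p k) (p (Suc k))"
    proof (rule dependent_nat_choice)
      show "\<exists>p. P p"
        by (rule exI[of _ "(\<lambda>i. if i < n then z i else m, Suc n)"]) (auto simp: P_def E_def)
    next
      fix p k assume P: "P p"
      then obtain y where y: "y \<in> E (fst p) (snd p) m" "F y \<in> (\<Inter>k. U j k)"
        using dense[of "fst p" "snd p"] unfolding P_def by blast
      then obtain l where l: "\<And>y'. \<forall>i<l. y' i = y i \<Longrightarrow> F y' \<in> U j k"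
        using cont[OF opn[of j k]] by blast
      define N where "N = max l (snd p)"
      have "P (y(N := m), Suc N)"
      proof -
        have "m \<le> y i" if "n \<le> i" for i
          using P y(1) that by (cases "i < snd p") (auto simp: P_def E_def)
        then show ?thesis
          using P y(1) by (auto simp: P_def E_def N_def)
      qed
      moreover have "R k p (y(N := m), Suc N)"
        unfolding R_def
      proof (intro conjI allI impI)
        show "\<exists>i\<ge>snd p. i < snd (y(N := m), Suc N) \<and> fst (y(N := m), Suc N) i = m"
          by (intro exI[of _ N]) (auto simp: N_def)
      next
        fix y' assume y': "\<forall>i<snd (y(N := m), Suc N). y' i = fst (y(N := m), Suc N) i"
        show "F y' \<in> U j k"
        proof (rule l, intro allI impI)
          fix i assume "i < l"
          then have "i < Suc N" "i \<noteq> N" by (auto simp: N_def)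
          then show "y' i = y i" using y' by simp
        qed
      qed (use y in \<open>auto simp: E_def N_def\<close>)
      ultimately show "\<exists>q. P q \<and> R k p q" by blast
    qed
    then obtain p where R: "\<And>k. R k (p k) (p (Suc k))" by blast
    obtain y where y: "\<And>k i. i < snd (p k) \<Longrightarrow> y i = fst (p k) i"
      by (rule fusion_limit[of "\<lambda>k. snd (p k)" "\<lambda>k. fst (p k)"]) (use R in \<open>auto simp: R_def\<close>)
    have "F y \<in> U j k" for k
      using R[of k] y unfolding R_def by blast
    then have "filterlim y at_top sequentially"
      using B reduces by blast
    then have "eventually (\<lambda>i. Suc m \<le> y i) sequentially"
      by (simp add: filterlim_at_top)
    then obtain N where N: "\<And>i. i \<ge> N \<Longrightarrow> Suc m \<le> y i"
      by (auto simp: eventually_sequentially)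
    have "strict_mono (\<lambda>k. snd (p k))"
      using R by (simp add: strict_mono_Suc_iff R_def)
    then have "N \<le> snd (p N)"
      using strict_mono_imp_increasing by blast
    moreover obtain i where "i \<ge> snd (p N)" "i < snd (p (Suc N))" "fst (p (Suc N)) i = m"
      using R[of N] unfolding R_def by blast
    ultimately show False
      using y[of i "Suc N"] N[of i] by simp
  qed
  define R where "R k p q \<longleftrightarrow> snd p < snd q \<and> fst q \<in> E (fst p) (snd p) k \<and>
      (\<forall>y\<in>E (fst q) (snd q) k. F y \<notin> (\<Inter>l. U k l))" for k and p q :: "(nat \<Rightarrow> nat) \<times> nat"
  have "\<exists>p. \<forall>k. True \<and> R k (p k) (p (Suc k))"
  proof (rule dependent_nat_choice)
    show "\<exists>q. True \<and> R k p q" for p k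
      using avoid[of "fst p" "snd p" k k] by (auto simp: R_def)
  qed simp
  then obtain p where R: "\<And>k. R k (p k) (p (Suc k))" by blast
  obtain y where y: "\<And>k i. i < snd (p k) \<Longrightarrow> y i = fst (p k) i"
    by (rule fusion_limit[of "\<lambda>k. snd (p k)" "\<lambda>k. fst (p k)"]) (use R in \<open>auto simp: R_def E_def\<close>)
  have "strict_mono (\<lambda>k. snd (p k))"
    using R by (simp add: strict_mono_Suc_iff R_def)
  then have incr: "k \<le> snd (p k)" for k
    using strict_mono_imp_increasing by blast
  \<comment> \<open>A coordinate that is not frozen at stage \<open>k\<close> has a value at least
    \<open>k\<close> in all later stages: either it has been frozen with such a value, or it is
    rewritten with an even larger lower bound.\<close>
  have later: "k \<le> fst (p (Suc (k + d))) i" if "i \<ge> snd (p k)" for k d i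
  proof (induction d)
    case 0
    then show ?case using R[of k] that by (auto simp: R_def E_def)
  next
    case (Suc d)
    show ?case
    proof (cases "i < snd (p (Suc (k + d)))")
      case True
      then show ?thesis using Suc R[of "Suc (k + d)"] by (simp add: R_def E_def)
    next
      case False
      then have "Suc (k + d) \<le> fst (p (Suc (Suc (k + d)))) i"
        using R[of "Suc (k + d)"] by (simp add: R_def E_def)
      then show ?thesis by simp
    qed
  qed
  have large: "k \<le> y i" if "i \<ge> snd (p k)" for k i
    using later[OF that, of i] y[of i "Suc (k + i)"] incr[of "Suc (k + i)"] by simp
  have "y \<in> E (fst (p (Suc k))) (snd (p (Suc k))) k" for k
    using y large[of "Suc k"] by (auto simp: E_def Suc_leD)
  then have "F y \<notin> B"
    using R unfolding B R_def by blast
  moreover have "filterlim y at_top sequentially"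
    unfolding filterlim_at_top eventually_sequentially using large by blast
  ultimately show False using reduces by blast
qed

subsection \<open>Sparse modifications of sequences\<close>

definition disagreements :: "(nat \<Rightarrow> 'a) \<Rightarrow> (nat \<Rightarrow> 'a) \<Rightarrow> nat \<Rightarrow> nat" where
  "disagreements x y N = card {i. i < N \<and> x i \<noteq> y i}"

lemma disagreements_commute: "disagreements x y = disagreements y x"
  by (auto simp: disagreements_def fun_eq_iff intro!: arg_cong[where f = card])

text \<open>An occurrence in \<open>x\<close> that is not one in \<open>y\<close> meets a
  disagreement at some offset \<open>i < length w\<close>. For a fixed offset, distinct occurrences
  meet distinct disagreements; the extra \<open>length w\<close> pays for those at positions from
  \<open>N\<close> on.\<close>

lemma occurrences_le_disagreements:
  "occurrences w x N \<le> occurrences w y N + length w * (disagreements x y N + length w)"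
proof -
  let ?D = "\<lambda>i. {l. l < N \<and> x (l + i) \<noteq> y (l + i)}"
  have card_D: "card (?D i) \<le> disagreements x y N + length w" if "i < length w" for i
  proof -
    have "card (?D i) = card ((\<lambda>l. l + i) ` ?D i)"
      by (subst card_image) auto
    also have "\<dots> \<le> card ({i. i < N \<and> x i \<noteq> y i} \<union> {N..<N + i})"
      by (intro card_mono) auto
    also have "\<dots> \<le> disagreements x y N + card {N..<N + i}"
      unfolding disagreements_def by (rule card_Un_le)
    finally show ?thesis using that by simp
  qed
  have "occurrences w x N \<le> card ({l. l < N \<and> appears_at w y l} \<union> (\<Union>i<length w. ?D i))"
    unfolding occurrences_def by (intro card_mono) (auto simp: appears_at_def)
  also have "\<dots> \<le> occurrences w y N + card (\<Union>i<length w. ?D i)"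
    unfolding occurrences_def by (rule card_Un_le)
  also have "card (\<Union>i<length w. ?D i) \<le> (\<Sum>i<length w. card (?D i))"
    by (rule card_UN_le) simp
  also have "\<dots> \<le> (\<Sum>i<length w. disagreements x y N + length w)"
    using card_D by (intro sum_mono) auto
  finally show ?thesis by simp
qed

lemma frequency_diff_le:
  "\<bar>frequency w x N - frequency w y N\<bar> \<le> real (length w * (disagreements x y N + length w)) / real N"
proof -
  have "\<bar>real (occurrences w x N) - real (occurrences w y N)\<bar>
      \<le> real (length w * (disagreements x y N + length w))"
    using occurrences_le_disagreements[of w x N y] occurrences_le_disagreements[of w y N x]
    unfolding disagreements_commute[of y x] by linarith
  then show ?thesis
    unfolding frequency_def by (simp add: divide_right_mono flip: diff_divide_distrib)
qed

text \<open>Stated along arbitrary times \<open>N k\<close>, since it is needed both along all times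
  and along the starting points of the windows.\<close>

lemma frequency_diff_tendsto_0:
  assumes "filterlim N at_top F"
    and "((\<lambda>k. real (disagreements x y (N k)) / real (N k)) \<longlongrightarrow> 0) F"
  shows "((\<lambda>k. frequency w x (N k) - frequency w y (N k)) \<longlongrightarrow> 0) F"
proof (rule Lim_null_comparison[OF always_eventually])
  have "filterlim (\<lambda>k. real (N k)) at_top F"
    using assms(1) filterlim_real_sequentially filterlim_compose by blast
  then have "((\<lambda>k. real (length w) / real (N k)) \<longlongrightarrow> 0) F"
    by (intro tendsto_divide_0[OF tendsto_const] filterlim_at_top_imp_at_infinity)
  then have "((\<lambda>k. real (length w) * (real (disagreements x y (N k)) / real (N k)
      + real (length w) / real (N k))) \<longlongrightarrow> real (length w) * (0 + 0)) F"
    by (intro tendsto_intros assms)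
  then show "((\<lambda>k. real (length w * (disagreements x y (N k) + length w)) / real (N k)) \<longlongrightarrow> 0) F"
    by (simp add: add_divide_distrib distrib_left)
qed (use frequency_diff_le in auto)

lemma occurrences_singleton: "occurrences [a] x N = card {l. l < N \<and> x l = a}"
  by (simp add: occurrences_def appears_at_def)

text \<open>The windows start at the fixed positions \<open>(n + 1)!\<close>, so that everything before a window is
  negligible compared with it, and have relative length \<open>1 / (z n + 1)\<close>.\<close>

definition window :: "(nat \<Rightarrow> nat) \<Rightarrow> nat \<Rightarrow> nat set" where
  "window z n = {fact (Suc n)..<fact (Suc n) + fact (Suc n) div Suc (z n)}"

definition mix :: "(nat \<Rightarrow> 'a) \<Rightarrow> (nat \<Rightarrow> 'a) \<Rightarrow> (nat \<Rightarrow> nat) \<Rightarrow> nat \<Rightarrow> 'a" where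
  "mix u v z i = (if i \<in> (\<Union>n. window z n) then v i else u i)"

text \<open>The window of index \<open>n\<close> starts at (n + 1)! > n, so position
  \<open>i\<close> can only lie in windows of index at most \<open>i\<close>. This is the continuity
  of the reduction.\<close>

lemma mix_cong:
  assumes "\<forall>n<Suc i. z' n = z n"
  shows "mix u v z' i = mix u v z i"
proof -
  have "window z' n = window z n" if "i \<in> window z n \<or> i \<in> window z' n" for n
  proof -
    have "fact (Suc n) \<le> i" using that by (auto simp: window_def)
    then have "n < Suc i" using fact_ge_self[of "Suc n"] by linarith
    then show ?thesis using assms by (simp add: window_def)
  qed
  then show ?thesis unfolding mix_def by (smt (verit) UN_iff)
qed

text \<open>A window that starts before (m + 1)! has index \<open>n < m\<close>, and it ends by 2 (n
  + 1)!, hence by 2 m!. So all windows before the \<open>m\<close>-th one are negligible at its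
  start.\<close>

lemma window_bound:
  assumes "i \<in> window z n" "i < fact (Suc m)"
  shows "i < 2 * fact m"
proof -
  have "fact (Suc n) < (fact (Suc m) :: nat)"
    using assms unfolding window_def atLeastLessThan_iff by linarith
  then have "n < m"
    using fact_mono_nat[of "Suc m" "Suc n"] by (meson Suc_le_mono not_le)
  then have "fact (Suc n) \<le> (fact m :: nat)"
    by (intro fact_mono_nat) simp
  moreover have "i < 2 * fact (Suc n)"
    using assms(1) div_le_dividend[of "fact (Suc n)" "Suc (z n)"]
    unfolding window_def atLeastLessThan_iff by linarith
  ultimately show ?thesis by linarith
qed

lemma disagreements_mix_fact: "disagreements (mix u v z) u (fact (Suc m)) \<le> 2 * fact m"
proof -
  have "disagreements (mix u v z) u (fact (Suc m)) \<le> card {..<2 * fact m :: nat}"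
    unfolding disagreements_def
    by (intro card_mono) (auto simp: mix_def dest: window_bound simp del: fact_Suc split: if_splits)
  then show ?thesis by simp
qed

text \<open>Until the window of index \<open>m + 1\<close> starts, a disagreement lies in window
  \<open>m\<close> or in an earlier window, and all earlier windows lie below 2 m!.\<close>

lemma disagreements_mix:
  assumes "N < fact (Suc (Suc m))"
  shows "disagreements (mix u v z) u N \<le> 2 * fact m + fact (Suc m) div Suc (z m)"
proof -
  have "{i. i < N \<and> mix u v z i \<noteq> u i} \<subseteq> {..<2 * fact m} \<union> window z m"
  proof
    fix i assume i: "i \<in> {i. i < N \<and> mix u v z i \<noteq> u i}"
    then obtain n where n: "i \<in> window z n" by (auto simp: mix_def split: if_splits)
    have "fact (Suc n) < (fact (Suc (Suc m)) :: nat)"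
      using n i assms unfolding window_def atLeastLessThan_iff mem_Collect_eq by linarith
    then have "n \<le> m"
      using fact_mono_nat[of "Suc (Suc m)" "Suc n"] by (meson Suc_le_mono not_less_eq_eq not_le)
    show "i \<in> {..<2 * fact m} \<union> window z m"
    proof (cases "n = m")
      case False
      then have "fact (Suc n) \<le> (fact m :: nat)"
        using \<open>n \<le> m\<close> by (intro fact_mono_nat) simp
      moreover have "i < 2 * fact (Suc n)"
        using n div_le_dividend[of "fact (Suc n)" "Suc (z n)"]
        unfolding window_def atLeastLessThan_iff by linarith
      ultimately have "i < 2 * fact m" by linarith
      then show ?thesis by simp
    qed (use n in simp)
  qed
  then have "disagreements (mix u v z) u N \<le> card ({..<2 * fact m} \<union> window z m)"
    unfolding disagreements_def by (intro card_mono) (auto simp: window_def)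
  also have "\<dots> \<le> card {..<2 * fact m :: nat} + card (window z m)"
    by (rule card_Un_le)
  finally show ?thesis by (simp add: window_def)
qed

lemma ex_fact_bracket:
  fixes N :: nat
  assumes "1 \<le> N"
  shows "\<exists>m. fact (Suc m) \<le> N \<and> N < fact (Suc (Suc m))"
proof -
  define m where "m = (LEAST m. N < fact (Suc (Suc m)))"
  have "N < fact (Suc (Suc N))"
    using fact_ge_self[of "Suc (Suc N)"] by linarith
  then have "N < fact (Suc (Suc m))"
    unfolding m_def by (rule LeastI)
  moreover have "fact (Suc m) \<le> N"
  proof (cases m)
    case (Suc l)
    then have "\<not> N < fact (Suc (Suc l))"
      using not_less_Least[of l "\<lambda>m. N < fact (Suc (Suc m))"] unfolding m_def by simp
    then show ?thesis using Suc by simp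
  qed (use assms in simp)
  ultimately show ?thesis by blast
qed

lemma two_fact_div_fact_Suc: "real (2 * fact m) / real (fact (Suc m)) = 2 / real (Suc m)"
proof -
  have "real (2 * fact m) = fact m * 2" "real (fact (Suc m)) = fact m * real (Suc m)"
    by (simp_all add: algebra_simps)
  then show ?thesis
    by (simp only: mult_divide_mult_cancel_left[OF fact_nonzero])
qed

text \<open>For \<open>N\<close> between (m + 1)! and (m + 2)! the density is at most 2 / (m + 1) +
  1 / (z m + 1): the earlier windows give the first summand and window \<open>m\<close> the
  second.\<close>

lemma mix_disagreements_density_0:
  assumes "filterlim z at_top sequentially"
  shows "(\<lambda>N. real (disagreements (mix u v z) u N) / real N) \<longlonglongrightarrow> 0"
proof (rule LIMSEQ_I)
  fix e :: real assume "0 < e"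
  have "(\<lambda>m. 2 / real (Suc m) + 1 / real (Suc (z m))) \<longlonglongrightarrow> 0 + 0"
  proof (intro tendsto_add)
    show "(\<lambda>m. 2 / real (Suc m)) \<longlonglongrightarrow> 0"
      using LIMSEQ_Suc[OF lim_const_over_n[of "2::real"]] by simp
    have "(\<lambda>m. 1 / real (Suc m)) \<longlonglongrightarrow> 0"
      using LIMSEQ_Suc[OF lim_const_over_n[of "1::real"]] by simp
    then show "(\<lambda>m. 1 / real (Suc (z m))) \<longlonglongrightarrow> 0"
      using assms by (rule filterlim_compose)
  qed
  then have "eventually (\<lambda>m. 2 / real (Suc m) + 1 / real (Suc (z m)) < e) sequentially"
    using \<open>0 < e\<close> by (intro order_tendstoD) auto
  then obtain K where K: "\<And>m. m \<ge> K \<Longrightarrow> 2 / real (Suc m) + 1 / real (Suc (z m)) < e"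
    by (auto simp: eventually_sequentially)
  have "norm (real (disagreements (mix u v z) u N) / real N - 0) < e" if N: "N \<ge> fact (Suc K)" for N
  proof -
    have N1: "1 \<le> N" using N fact_ge_1[of "Suc K", where 'a=nat] by linarith
    then obtain m where m: "fact (Suc m) \<le> N" "N < fact (Suc (Suc m))"
      using ex_fact_bracket by blast
    then have "K \<le> m"
      using N fact_mono_nat[of "Suc (Suc m)" "Suc K"] by (meson Suc_le_mono not_less_eq_eq not_le le_less_trans)
    have "real (disagreements (mix u v z) u N) / real N
        \<le> real (2 * fact m + fact (Suc m) div Suc (z m)) / real (fact (Suc m))"
    proof (rule frac_le)
      show "real (disagreements (mix u v z) u N) \<le> real (2 * fact m + fact (Suc m) div Suc (z m))"
        using disagreements_mix[OF m(2)] by (rule of_nat_mono)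
      show "real (fact (Suc m)) \<le> real N"
        using m(1) by (rule of_nat_mono)
    qed (simp_all del: fact_Suc)
    also have "\<dots> = 2 / real (Suc m) + real (fact (Suc m) div Suc (z m)) / real (fact (Suc m))"
      unfolding two_fact_div_fact_Suc[symmetric] by (simp only: of_nat_add add_divide_distrib)
    also have "\<dots> \<le> 2 / real (Suc m) + (real (fact (Suc m)) / real (Suc (z m))) / real (fact (Suc m))"
      by (intro add_left_mono divide_right_mono of_nat_div_le_of_nat) auto
    also have "\<dots> = 2 / real (Suc m) + 1 / real (Suc (z m))"
      by (simp del: fact_Suc)
    also have "\<dots> < e" using K \<open>K \<le> m\<close> by blast
    finally show ?thesis by simp
  qed
  then show "\<exists>no. \<forall>N\<ge>no. norm (real (disagreements (mix u v z) u N) / real N - 0) < e"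
    by blast
qed

lemma mix_same_frequencies:
  assumes "filterlim z at_top sequentially"
  shows "(\<lambda>N. frequency w (mix u v z) N - frequency w u N) \<longlonglongrightarrow> 0"
  using frequency_diff_tendsto_0[OF filterlim_ident mix_disagreements_density_0[OF assms, of u v]] by simp

lemma filterlim_fact_Suc: "filterlim (\<lambda>m. fact (Suc m) :: nat) at_top sequentially"
proof (rule filterlim_at_top_mono[OF filterlim_ident], rule always_eventually, rule allI)
  show "m \<le> fact (Suc m)" for m
    using fact_ge_self[of "Suc m"] by linarith
qed

text \<open>At the start of window \<open>m\<close> the density of disagreements is at most 2 / (m +
  1) for every \<open>z\<close>. Hence along these times the mixture always has the limits of
  \<open>u\<close>.\<close>

lemma mix_frequency_at_fact:
  "(\<lambda>m. frequency w (mix u v z) (fact (Suc m)) - frequency w u (fact (Suc m))) \<longlonglongrightarrow> 0"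
proof (rule frequency_diff_tendsto_0)
  show "filterlim (\<lambda>m. fact (Suc m) :: nat) at_top sequentially"
    by (rule filterlim_fact_Suc)
  show "(\<lambda>m. real (disagreements (mix u v z) u (fact (Suc m))) / real (fact (Suc m))) \<longlonglongrightarrow> 0"
  proof (rule Lim_null_comparison[OF always_eventually])
    show "(\<lambda>m. 2 / real (Suc m)) \<longlonglongrightarrow> 0"
      using LIMSEQ_Suc[OF lim_const_over_n[of "2::real"]] by simp
    show "\<forall>m. norm (real (disagreements (mix u v z) u (fact (Suc m))) / real (fact (Suc m)))
        \<le> 2 / real (Suc m)"
    proof
      fix m
      have "real (disagreements (mix u v z) u (fact (Suc m))) / real (fact (Suc m))
          \<le> real (2 * fact m) / real (fact (Suc m))"
        using disagreements_mix_fact[of u v z m] by (intro divide_right_mono of_nat_mono) auto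
      also have "\<dots> = 2 / real (Suc m)" by (rule two_fact_div_fact_Suc)
      finally show "norm (real (disagreements (mix u v z) u (fact (Suc m))) / real (fact (Suc m)))
          \<le> 2 / real (Suc m)" by simp
    qed
  qed
qed

text \<open>If every value were taken only finitely often, then for each \<open>K\<close> the
  finitely many values below \<open>K\<close> would eventually be avoided.\<close>

lemma ex_infinitely_often_eq:
  fixes z :: "nat \<Rightarrow> nat"
  assumes "\<not> filterlim z at_top sequentially"
  shows "\<exists>k. \<exists>\<^sub>F m in sequentially. z m = k"
proof (rule ccontr)
  assume "\<not> ?thesis"
  then have *: "\<forall>\<^sub>F m in sequentially. z m \<noteq> k" for k by (auto simp: frequently_def)
  have "\<forall>\<^sub>F m in sequentially. \<forall>k\<in>{..<K}. z m \<noteq> k" for K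
    using * by (intro eventually_ball_finite) auto
  then have "\<forall>\<^sub>F m in sequentially. K \<le> z m" for K
    by (rule eventually_mono) (use leI in blast)
  then show False using assms by (simp add: filterlim_at_top)
qed

text \<open>The starts of the windows force a possible limit \<open>L\<close> to be \<alpha>. The
  windows with \<open>z m = k\<close> make up a fixed proportion of the time up to their ends and
  consist of symbols of \<open>v\<close>, which forces \<open>L\<close> to be \<beta> as
  well.\<close>

lemma mix_frequency_diverges:
  assumes not_inf: "\<not> filterlim z at_top sequentially"
    and u: "frequency [a] u \<longlonglongrightarrow> \<alpha>" and v: "frequency [a] v \<longlonglongrightarrow> \<beta>" and "\<alpha> \<noteq> \<beta>"
  shows "\<not> convergent (frequency [a] (mix u v z))"
proof
  let ?s = "mix u v z"
  let ?N = "\<lambda>m. fact (Suc m) :: nat"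
  assume "convergent (frequency [a] ?s)"
  then obtain L where L: "frequency [a] ?s \<longlonglongrightarrow> L" unfolding convergent_def by blast
  obtain k where k: "\<exists>\<^sub>F m in sequentially. z m = k"
    using ex_infinitely_often_eq[OF not_inf] by blast
  have N: "filterlim ?N at_top sequentially"
    by (rule filterlim_fact_Suc)
  have "(\<lambda>m. frequency [a] ?s (?N m) - frequency [a] u (?N m)) \<longlonglongrightarrow> L - \<alpha>"
    using filterlim_compose[OF L N] filterlim_compose[OF u N] by (rule tendsto_diff)
  then have "L = \<alpha>"
    using LIMSEQ_unique[OF _ mix_frequency_at_fact] by fastforce
  define E where "E m = ?N m + ?N m div Suc k" for m
  have E: "filterlim E at_top sequentially"
    by (rule filterlim_at_top_mono[OF N]) (auto simp: E_def)
  \<comment> \<open>For \<open>m \<ge> k\<close> the number k + 1 divides (m + 1)!, so there is no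
    rounding: a window with \<open>z m = k\<close> ends at exactly \<open>r\<close> times its
    start.\<close>
  define r where "r = 1 + 1 / real (Suc k)"
  have E_N: "real (E m) = r * real (?N m)" if "m \<ge> k" for m
  proof -
    have "Suc k dvd ?N m" using that by (intro dvd_fact) auto
    then show ?thesis
      by (simp add: E_def r_def real_of_nat_div distrib_right del: fact_Suc)
  qed
  \<comment> \<open>Each bracket is the number of symbols \<open>a\<close> between
    \<open>?N m\<close> and \<open>E m\<close>, divided by \<open>?N m\<close>. The two brackets
    agree whenever the mixture copies \<open>v\<close> there, so \<open>\<delta>\<close> vanishes
    infinitely often and its limit is 0.\<close>
  define \<delta> where "\<delta> m = (r * frequency [a] ?s (E m) - frequency [a] ?s (?N m))
      - (r * frequency [a] v (E m) - frequency [a] v (?N m))" for m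
  have "\<delta> \<longlonglongrightarrow> (r * L - L) - (r * \<beta> - \<beta>)"
    unfolding \<delta>_def
    using filterlim_compose[OF L N] filterlim_compose[OF L E] filterlim_compose[OF v N]
      filterlim_compose[OF v E]
    by (intro tendsto_intros)
  moreover have "\<exists>\<^sub>F m in sequentially. \<delta> m = 0"
  proof (rule frequently_rev_mp[OF k])
    have zero: "\<delta> m = 0" if m: "m \<ge> k" "z m = k" for m
    proof -
      have count: "occurrences [a] x (E m) = occurrences [a] x (?N m) + card {l\<in>{?N m..<E m}. x l = a}"
        for x
        unfolding occurrences_singleton
        by (subst card_Un_disjoint[symmetric]) (auto simp: E_def simp del: fact_Suc intro!: arg_cong[where f=card])
      have "l \<in> window z m" if "l \<in> {?N m..<E m}" for l
        using that m by (simp add: window_def E_def del: fact_Suc)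
      then have "{l\<in>{?N m..<E m}. ?s l = a} = {l\<in>{?N m..<E m}. v l = a}"
        unfolding mix_def by auto
      then have "real (occurrences [a] ?s (E m)) - real (occurrences [a] ?s (?N m))
          = real (occurrences [a] v (E m)) - real (occurrences [a] v (?N m))"
        using count[of ?s] count[of v] by simp
      moreover have "r * frequency [a] x (E m) - frequency [a] x (?N m)
          = (real (occurrences [a] x (E m)) - real (occurrences [a] x (?N m))) / real (?N m)" for x
      proof -
        have "r > 0" unfolding r_def by (simp add: add_pos_pos)
        then show ?thesis
          unfolding frequency_def E_N[OF m(1)] by (simp add: diff_divide_distrib del: fact_Suc)
      qed
      ultimately show ?thesis unfolding \<delta>_def by simp
    qed
    show "\<forall>\<^sub>F m in sequentially. z m = k \<longrightarrow> \<delta> m = 0"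
      using zero by (intro eventually_sequentiallyI[of k]) auto
  qed
  ultimately have "(r * L - L) - (r * \<beta> - \<beta>) = 0"
    by (metis frequently_def tendsto_imp_eventually_ne)
  then have "(r - 1) * (L - \<beta>) = 0" by (simp add: algebra_simps)
  moreover have "r - 1 \<noteq> 0" by (simp add: r_def)
  ultimately show False using \<open>L = \<alpha>\<close> \<open>\<alpha> \<noteq> \<beta>\<close> by simp
qed

subsection \<open>Birkhoff's ergodic theorem\<close>

lemma sum_lessThan_add:
  fixes g :: "nat \<Rightarrow> 'a :: comm_monoid_add"
  shows "(\<Sum>j<n + m. g j) = (\<Sum>j<n. g j) + (\<Sum>j<m. g (n + j))"
  by (induction m) (simp_all add: add.assoc)

text \<open>Blocks are laid end to end until at most \<open>R\<close> terms remain. The remainder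
  has a nonnegative sum, and ignoring it costs at most \<open>R\<close> because
  \<open>c \<le> 1\<close>.\<close>

lemma sum_ge_if_block_sums_ge:
  fixes h :: "nat \<Rightarrow> real" and c :: real
  assumes nonneg: "\<And>i. 0 \<le> h i" and "c \<le> 1"
    and block: "\<And>i. \<exists>n\<ge>1. n \<le> R \<and> real n * c \<le> (\<Sum>j<n. h (i + j))"
  shows "real L * c - real R \<le> (\<Sum>j<L. h (i + j))"
proof (induction L arbitrary: i rule: less_induct)
  case (less L)
  show ?case
  proof (cases "L \<le> R")
    case True
    have "real L * c \<le> real L * 1"
      using \<open>c \<le> 1\<close> by (intro mult_left_mono) auto
    then have "real L * c - real R \<le> 0" using True by linarith
    also have "0 \<le> (\<Sum>j<L. h (i + j))" by (intro sum_nonneg nonneg)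
    finally show ?thesis .
  next
    case False
    obtain n where n: "n \<ge> 1" "n \<le> R" "real n * c \<le> (\<Sum>j<n. h (i + j))"
      using block by blast
    have "real (L - n) * c - real R \<le> (\<Sum>j<L - n. h (i + n + j))"
      using n False by (intro less) auto
    moreover have "(\<Sum>j<L. h (i + j)) = (\<Sum>j<n. h (i + j)) + (\<Sum>j<L - n. h (i + n + j))"
      using sum_lessThan_add[of "\<lambda>j. h (i + j)" n "L - n"] n False by (simp add: add.assoc)
    ultimately show ?thesis
      using n False by (simp add: of_nat_diff algebra_simps)
  qed
qed

definition birkhoff_average :: "('a \<Rightarrow> 'a) \<Rightarrow> ('a \<Rightarrow> real) \<Rightarrow> nat \<Rightarrow> 'a \<Rightarrow> real" where
  "birkhoff_average T f N x = (\<Sum>i<N. f ((T ^^ i) x)) / real N"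

text \<open>The upper limit is formed in the extended reals, where it always exists. For functions
  with values between 0 and 1 it is finite, so the conversion loses nothing.\<close>

definition birkhoff_limsup :: "('a \<Rightarrow> 'a) \<Rightarrow> ('a \<Rightarrow> real) \<Rightarrow> 'a \<Rightarrow> real" where
  "birkhoff_limsup T f x = real_of_ereal (limsup (\<lambda>N. ereal (birkhoff_average T f N x)))"

text \<open>The bounds 0 and 1 make all functions involved integrable and are preserved by passing
  to \<open>1 - f\<close>, which exchanges upper and lower limits. Indicators of cylinders are the
  intended instances.\<close>

locale unit_observable = prob_space M for M :: "'a measure" +
  fixes T :: "'a \<Rightarrow> 'a" and f :: "'a \<Rightarrow> real"
  assumes measurable_T [measurable]: "T \<in> measurable M M"
    and invariant: "distr M M T = M"
    and measurable_f [measurable]: "f \<in> borel_measurable M"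
    and f_nonneg: "0 \<le> f x" and f_le_1: "f x \<le> 1"
begin

lemma measurable_iterate [measurable]: "T ^^ i \<in> measurable M M"
  by (induction i) auto

lemma iterate_space: "x \<in> space M \<Longrightarrow> (T ^^ i) x \<in> space M"
  using measurable_space[OF measurable_iterate] .

lemma distr_iterate: "distr M M (T ^^ i) = M"
proof (induction i)
  case (Suc i)
  have "distr M M (T ^^ Suc i) = distr (distr M M (T ^^ i)) M T"
    by (subst distr_distr) auto
  then show ?case using Suc invariant by (simp add: o_def)
qed (simp add: distr_id2)

lemma integral_iterate:
  fixes g :: "'a \<Rightarrow> real"
  assumes "g \<in> borel_measurable M"
  shows "(\<integral>x. g ((T ^^ i) x) \<partial>M) = (\<integral>x. g x \<partial>M)"
  using integral_distr[OF measurable_iterate assms, of i] by (simp add: distr_iterate)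

lemma birkhoff_average_bounds: "0 \<le> birkhoff_average T f N x" "birkhoff_average T f N x \<le> 1"
proof -
  have "(\<Sum>i<N. f ((T ^^ i) x)) \<le> (\<Sum>i<N. 1)"
    by (intro sum_mono f_le_1)
  then show "birkhoff_average T f N x \<le> 1"
    unfolding birkhoff_average_def by (auto simp: divide_le_eq)
  show "0 \<le> birkhoff_average T f N x"
    unfolding birkhoff_average_def by (intro divide_nonneg_nonneg sum_nonneg f_nonneg) auto
qed

lemma ereal_birkhoff_limsup:
  "ereal (birkhoff_limsup T f x) = limsup (\<lambda>N. ereal (birkhoff_average T f N x))"
proof -
  have "0 \<le> limsup (\<lambda>N. ereal (birkhoff_average T f N x))"
    using birkhoff_average_bounds by (intro le_Limsup) auto
  moreover have "limsup (\<lambda>N. ereal (birkhoff_average T f N x)) \<le> 1"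
    using birkhoff_average_bounds by (intro Limsup_bounded) auto
  ultimately show ?thesis
    unfolding birkhoff_limsup_def by (intro ereal_real') auto
qed

lemma birkhoff_limsup_bounds: "0 \<le> birkhoff_limsup T f x" "birkhoff_limsup T f x \<le> 1"
proof -
  have "0 \<le> limsup (\<lambda>N. ereal (birkhoff_average T f N x))"
    using birkhoff_average_bounds by (intro le_Limsup) auto
  moreover have "limsup (\<lambda>N. ereal (birkhoff_average T f N x)) \<le> 1"
    using birkhoff_average_bounds by (intro Limsup_bounded) auto
  ultimately show "0 \<le> birkhoff_limsup T f x" "birkhoff_limsup T f x \<le> 1"
    unfolding ereal_birkhoff_limsup[symmetric] by simp_all
qed

lemma measurable_birkhoff_average [measurable]: "birkhoff_average T f N \<in> borel_measurable M"
  unfolding birkhoff_average_def by measurable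

lemma measurable_birkhoff_limsup [measurable]: "birkhoff_limsup T f \<in> borel_measurable M"
  unfolding birkhoff_limsup_def by measurable

text \<open>The orbit sum of length N + 1 at \<open>x\<close> is \<open>f x\<close> plus the orbit
  sum of length N at \<open>T x\<close>, so the two averages differ by at most 2 / (N + 1).\<close>

lemma birkhoff_limsup_invariant: "birkhoff_limsup T f (T x) = birkhoff_limsup T f x"
proof -
  let ?a = "\<lambda>N. birkhoff_average T f N (T x)" and ?b = "\<lambda>N. birkhoff_average T f (Suc N) x"
  have diff: "\<bar>?b N - ?a N\<bar> \<le> 2 / real (Suc N)" for N
  proof -
    have "(\<Sum>i<Suc N. f ((T ^^ i) x)) = f x + (\<Sum>i<N. f ((T ^^ i) (T x)))"
      by (subst sum.lessThan_Suc_shift) (simp add: funpow_swap1)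
    then have "real (Suc N) * ?b N = f x + real N * ?a N"
      unfolding birkhoff_average_def by simp
    then have "real (Suc N) * (?b N - ?a N) = f x - ?a N"
      by (simp add: algebra_simps)
    moreover have "\<bar>f x - ?a N\<bar> \<le> 2"
      using f_nonneg[of x] f_le_1[of x] birkhoff_average_bounds[of N "T x"] by linarith
    ultimately have "real (Suc N) * \<bar>?b N - ?a N\<bar> \<le> 2"
      by (metis abs_mult abs_of_nat)
    then show ?thesis by (simp add: field_simps)
  qed
  have "(\<lambda>N. ?b N - ?a N) \<longlonglongrightarrow> 0"
  proof (rule Lim_null_comparison[of _ "\<lambda>N. 2 / real (Suc N)"])
    show "(\<lambda>N. 2 / real (Suc N)) \<longlonglongrightarrow> 0"
      using LIMSEQ_Suc[OF lim_const_over_n[of "2::real"]] by simp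
  qed (use diff in auto)
  then have "(\<lambda>N. ereal (?b N - ?a N)) \<longlonglongrightarrow> 0"
    by (simp add: zero_ereal_def)
  then have "limsup (\<lambda>N. ereal (?b N - ?a N) + ereal (?a N)) = 0 + limsup (\<lambda>N. ereal (?a N))"
    by (rule ereal_limsup_lim_add) auto
  then have "limsup (\<lambda>N. ereal (?b N)) = limsup (\<lambda>N. ereal (?a N))"
    by simp
  then show ?thesis
    unfolding birkhoff_limsup_def
    using limsup_shift[of "\<lambda>N. ereal (birkhoff_average T f N x)"] by simp
qed

lemma birkhoff_limsup_iterate: "birkhoff_limsup T f ((T ^^ i) x) = birkhoff_limsup T f x"
  by (induction i) (auto simp: birkhoff_limsup_invariant)

lemma ex_birkhoff_average_gt:
  assumes "0 < e"
  shows "\<exists>n\<ge>1. birkhoff_limsup T f x - e < birkhoff_average T f n x"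
proof (rule ccontr)
  assume "\<not> ?thesis"
  then have "\<forall>n\<ge>1. birkhoff_average T f n x \<le> birkhoff_limsup T f x - e" by force
  then have "limsup (\<lambda>N. ereal (birkhoff_average T f N x)) \<le> ereal (birkhoff_limsup T f x - e)"
    by (intro Limsup_bounded) (auto simp: eventually_sequentially)
  then show False
    using assms by (simp flip: ereal_birkhoff_limsup)
qed

lemma integrable_unit:
  fixes g :: "'a \<Rightarrow> real"
  assumes "g \<in> borel_measurable M" "\<And>x. 0 \<le> g x" "\<And>x. g x \<le> 1"
  shows "integrable M g"
  using assms by (intro integrable_const_bound[of _ 1]) auto

text \<open>The argument of Katznelson and Weiss: outside a set of small measure, every point has an
  average within \<open>e\<close> of the upper limit over a window of length at most \<open>R\<close>. After raising \<open>f\<close>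
  to 1 on the exceptional set, every long orbit segment is tiled by such windows.\<close>

lemma integral_birkhoff_limsup_le: "(\<integral>x. birkhoff_limsup T f x \<partial>M) \<le> (\<integral>x. f x \<partial>M)"
proof (rule field_le_epsilon)
  fix e :: real assume e: "0 < e"
  let ?g = "birkhoff_limsup T f"
  define bad where "bad R = {x \<in> space M. \<forall>n\<in>{1..R}. birkhoff_average T f n x \<le> ?g x - e}" for R
  have bad [measurable]: "bad R \<in> sets M" for R
    unfolding bad_def by measurable
  have int_g: "integrable M ?g" and int_f: "integrable M f"
    using birkhoff_limsup_bounds f_nonneg f_le_1 by (auto intro!: integrable_unit)
  have bound: "(\<integral>x. ?g x \<partial>M) - e \<le> (\<integral>x. f x \<partial>M) + measure M (bad R)" if R: "R \<ge> 1" for R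
  proof -
    define h where "h x = (if x \<in> bad R then 1 else f x)" for x
    have h [measurable]: "h \<in> borel_measurable M"
      unfolding h_def by measurable
    have h_bounds: "0 \<le> h x" "h x \<le> 1" "f x \<le> h x" for x
      using f_nonneg f_le_1 by (auto simp: h_def)
    have int_h: "integrable M h" and int_hi: "integrable M (\<lambda>x. h ((T ^^ i) x))" for i
      using h_bounds by (auto intro!: integrable_unit)
    have pointwise: "real L * (?g x - e) - real R \<le> (\<Sum>i<L. h ((T ^^ i) x))"
      if x: "x \<in> space M" for L x
    proof -
      \<comment> \<open>By invariance of the upper limit the target \<open>?g x - e\<close> is the
        same along the whole orbit, as the tiling requires.\<close>
      have "\<exists>n\<ge>1. n \<le> R \<and> real n * (?g x - e) \<le> (\<Sum>j<n. h ((T ^^ (i + j)) x))" for i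
      proof -
        let ?y = "(T ^^ i) x"
        have y: "?y \<in> space M" using x by (rule iterate_space)
        have shift: "(T ^^ (i + j)) x = (T ^^ j) ?y" for j
          by (metis add.commute comp_apply funpow_add)
        show ?thesis
        proof (cases "?y \<in> bad R")
          \<comment> \<open>A block of length 1 suffices here: \<open>h\<close> is 1 at an
            exceptional point and the upper limit is at most 1.\<close>
          case True
          then have "h ?y = 1" by (simp add: h_def)
          then show ?thesis
            using R e birkhoff_limsup_bounds[of x] by (intro exI[of _ 1]) auto
        next
          case False
          then obtain n where n: "n \<ge> 1" "n \<le> R" "?g ?y - e < birkhoff_average T f n ?y"
            using y by (auto simp: bad_def not_le)
          have "real n * (?g x - e) \<le> real n * birkhoff_average T f n ?y"
            using n birkhoff_limsup_iterate[of i x] by (intro mult_left_mono) auto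
          also have "\<dots> = (\<Sum>j<n. f ((T ^^ j) ?y))"
            using n by (simp add: birkhoff_average_def)
          also have "\<dots> \<le> (\<Sum>j<n. h ((T ^^ j) ?y))"
            by (intro sum_mono h_bounds)
          finally show ?thesis
            using n by (auto simp: shift)
        qed
      qed
      then show ?thesis
        using sum_ge_if_block_sums_ge[of "\<lambda>i. h ((T ^^ i) x)" "?g x - e" R L 0]
          h_bounds e birkhoff_limsup_bounds[of x] by simp
    qed
    \<comment> \<open>Integrating the pointwise bound gives the same error \<open>R\<close> for
      every \<open>L\<close>; as \<open>L\<close> is arbitrary, the factor of \<open>L\<close>
      cannot be positive.\<close>
    have "real L * ((\<integral>x. ?g x \<partial>M) - e - (\<integral>x. h x \<partial>M)) \<le> real R" for L
    proof -
      have "(\<integral>x. real L * (?g x - e) - real R \<partial>M) \<le> (\<integral>x. (\<Sum>i<L. h ((T ^^ i) x)) \<partial>M)"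
        using int_g int_hi pointwise by (intro integral_mono) auto
      also have "\<dots> = real L * (\<integral>x. h x \<partial>M)"
        using int_hi by (simp add: integral_iterate)
      finally show ?thesis
        using int_g by (simp add: prob_space algebra_simps)
    qed
    then have "(\<integral>x. ?g x \<partial>M) - e - (\<integral>x. h x \<partial>M) \<le> 0"
      using ex_less_of_nat_mult[of "(\<integral>x. ?g x \<partial>M) - e - (\<integral>x. h x \<partial>M)" "real R"]
      by (meson linorder_not_less)
    moreover have "(\<integral>x. h x \<partial>M) \<le> (\<integral>x. f x + indicator (bad R) x \<partial>M)"
    proof (rule integral_mono)
      show "h x \<le> f x + indicator (bad R) x" for x
        using f_nonneg[of x] by (simp add: h_def)
    qed (use int_h int_f in \<open>auto simp: emeasure_eq_measure\<close>)
    ultimately show ?thesis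
      using int_f by (simp add: emeasure_eq_measure)
  qed
  have "(\<lambda>R. measure M (bad R)) \<longlonglongrightarrow> measure M (\<Inter>R. bad R)"
  proof (rule finite_Lim_measure_decseq)
    show "decseq bad" unfolding decseq_def bad_def by auto
  qed auto
  moreover have "(\<Inter>R. bad R) = {}"
  proof (rule equals0I)
    fix x assume x: "x \<in> (\<Inter>R. bad R)"
    obtain n where "n \<ge> 1" "?g x - e < birkhoff_average T f n x"
      using ex_birkhoff_average_gt[OF e] by blast
    moreover have "x \<in> bad n" using x by blast
    then have "birkhoff_average T f n x \<le> ?g x - e"
      using \<open>n \<ge> 1\<close> by (auto simp: bad_def)
    ultimately show False by simp
  qed
  ultimately have "(\<lambda>R. (\<integral>x. f x \<partial>M) + measure M (bad R)) \<longlonglongrightarrow> (\<integral>x. f x \<partial>M) + 0"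
    by (intro tendsto_add tendsto_const) simp
  then have "(\<integral>x. ?g x \<partial>M) - e \<le> (\<integral>x. f x \<partial>M) + 0"
    by (rule LIMSEQ_le_const) (use bound in blast)
  then show "(\<integral>x. ?g x \<partial>M) \<le> (\<integral>x. f x \<partial>M) + e" by simp
qed

end

text \<open>The inequality for \<open>f\<close> and for \<open>1 - f\<close> gives a cycle: the
  integral of \<open>f\<close> is at most that of the lower limit, then that of the upper limit,
  then that of \<open>f\<close> again. So the lower and upper limits have equal integrals and agree
  almost everywhere.\<close>

theorem (in unit_observable) birkhoff:
  "AE x in M. (\<lambda>N. birkhoff_average T f N x) \<longlonglongrightarrow> birkhoff_limsup T f x"
  "(\<integral>x. birkhoff_limsup T f x \<partial>M) = (\<integral>x. f x \<partial>M)"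
proof -
  let ?f' = "\<lambda>x. 1 - f x"
  interpret co: unit_observable M T ?f'
    using f_nonneg f_le_1 invariant by unfold_locales (auto simp: algebra_simps)
  let ?g = "birkhoff_limsup T f" and ?l = "\<lambda>x. 1 - birkhoff_limsup T ?f' x"
  \<comment> \<open>At \<open>N = 0\<close> both averages are 0 by the convention for division by
    zero, so the identity holds only from 1 on.\<close>
  have avg: "birkhoff_average T ?f' N x = 1 - birkhoff_average T f N x" if "N \<ge> 1" for N x
    using that by (simp add: birkhoff_average_def sum_subtractf diff_divide_distrib)
  have liminf: "liminf (\<lambda>N. ereal (birkhoff_average T f N x)) = ereal (?l x)" for x
  proof -
    have "limsup (\<lambda>N. ereal (birkhoff_average T ?f' N x))
        = limsup (\<lambda>N. 1 + - ereal (birkhoff_average T f N x))"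
      by (intro Limsup_eq eventually_sequentiallyI[of 1]) (simp add: avg one_ereal_def)
    also have "\<dots> = 1 + limsup (\<lambda>N. - ereal (birkhoff_average T f N x))"
      by (rule ereal_limsup_lim_add) auto
    also have "\<dots> = 1 - liminf (\<lambda>N. ereal (birkhoff_average T f N x))"
      by (simp add: ereal_Limsup_uminus minus_ereal_def del: uminus_ereal.simps)
    finally have "ereal (birkhoff_limsup T ?f' x) = 1 - liminf (\<lambda>N. ereal (birkhoff_average T f N x))"
      by (simp add: co.ereal_birkhoff_limsup)
    then show ?thesis
      by (cases "liminf (\<lambda>N. ereal (birkhoff_average T f N x))") (auto simp: one_ereal_def)
  qed
  have le: "?l x \<le> ?g x" for x
  proof -
    have "ereal (?l x) \<le> ereal (?g x)"
      using Liminf_le_Limsup[of sequentially "\<lambda>N. ereal (birkhoff_average T f N x)"]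
      by (simp only: liminf ereal_birkhoff_limsup trivial_limit_sequentially not_False_eq_True)
    then show ?thesis by simp
  qed
  have int: "integrable M f" "integrable M ?g" "integrable M (birkhoff_limsup T ?f')"
    using f_nonneg f_le_1 birkhoff_limsup_bounds co.birkhoff_limsup_bounds
    by (auto intro!: integrable_unit)
  have "(\<integral>x. f x \<partial>M) \<le> (\<integral>x. ?l x \<partial>M)"
    using co.integral_birkhoff_limsup_le int by (simp add: prob_space)
  moreover have "(\<integral>x. ?l x \<partial>M) \<le> (\<integral>x. ?g x \<partial>M)"
    using int le by (intro integral_mono) auto
  moreover note integral_birkhoff_limsup_le
  ultimately have eq: "(\<integral>x. ?l x \<partial>M) = (\<integral>x. ?g x \<partial>M)" "(\<integral>x. ?g x \<partial>M) = (\<integral>x. f x \<partial>M)"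
    by linarith+
  show "(\<integral>x. ?g x \<partial>M) = (\<integral>x. f x \<partial>M)" by (rule eq)
  have "(\<integral>x. ?g x - ?l x \<partial>M) = 0"
    using eq int by simp
  then have "AE x in M. ?g x - ?l x = 0"
    using int le by (subst (asm) integral_nonneg_eq_0_iff_AE) auto
  then show "AE x in M. (\<lambda>N. birkhoff_average T f N x) \<longlonglongrightarrow> ?g x"
  proof eventually_elim
    case (elim x)
    then have "(\<lambda>N. ereal (birkhoff_average T f N x)) \<longlonglongrightarrow> ereal (?g x)"
      by (intro Liminf_eq_Limsup) (auto simp: liminf ereal_birkhoff_limsup[symmetric])
    then show ?case by simp
  qed
qed

text \<open>The set where the upper limit exceeds the mean is invariant, so it has measure 0 or 1.
  In both cases the difference has constant sign almost everywhere and integral 0, hence it vanishes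
  almost everywhere.\<close>

theorem (in unit_observable) birkhoff_ergodic:
  assumes ergodic: "\<And>S. S \<in> sets M \<Longrightarrow> T -` S \<inter> space M = S \<Longrightarrow> measure M S \<in> {0, 1}"
  shows "AE x in M. (\<lambda>N. birkhoff_average T f N x) \<longlonglongrightarrow> (\<integral>x. f x \<partial>M)"
proof -
  let ?g = "birkhoff_limsup T f" and ?c = "\<integral>x. f x \<partial>M"
  let ?S = "{x \<in> space M. ?c < ?g x}"
  have int: "integrable M ?g"
    using birkhoff_limsup_bounds by (auto intro!: integrable_unit)
  have S: "?S \<in> sets M" by measurable
  moreover have "T -` ?S \<inter> space M = ?S"
    using measurable_space[OF measurable_T] by (auto simp: birkhoff_limsup_invariant)
  ultimately consider "measure M ?S = 0" | "measure M ?S = 1"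
    using ergodic by blast
  then have "AE x in M. ?g x = ?c"
  proof cases
    case 1
    then have "AE x in M. x \<notin> ?S"
      using prob_eq_0[OF S] by simp
    then have "AE x in M. 0 \<le> ?c - ?g x"
      by (rule AE_mp) (auto intro!: AE_I2)
    then have "AE x in M. ?c - ?g x = 0"
      using int birkhoff(2) by (subst integral_nonneg_eq_0_iff_AE[symmetric]) (auto simp: prob_space)
    then show ?thesis by eventually_elim auto
  next
    case 2
    then have "AE x in M. x \<in> ?S"
      using prob_eq_1[OF S] by simp
    then have "AE x in M. 0 \<le> ?g x - ?c"
      by (rule AE_mp) (auto intro!: AE_I2)
    then have "AE x in M. ?g x - ?c = 0"
      using int birkhoff(2) by (subst integral_nonneg_eq_0_iff_AE[symmetric]) (auto simp: prob_space)
    then show ?thesis by eventually_elim auto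
  qed
  with birkhoff(1) show ?thesis
    by eventually_elim simp
qed

subsection \<open>Safe symbols and frequencies\<close>

lemma subshift_subset_seqs: "subshift A X \<Longrightarrow> X \<subseteq> seqs A"
  using closedin_subset[of "seq_topology A" X] by (simp add: subshift_def)

text \<open>Replacing finitely many symbols by the safe one stays in \<open>X\<close>. The masked
  sequence is a limit of such finite modifications and \<open>X\<close> is closed.\<close>

lemma safe_masking:
  assumes X: "subshift A X" and safe: "safe_symbol A X \<gamma>" and x: "x \<in> X"
    and y: "\<And>i. y i = x i \<or> y i = \<gamma>"
  shows "y \<in> X"
proof (rule ccontr)
  assume "y \<notin> X"
  have "y i \<in> A" for i
    using y[of i] x subshift_subset_seqs[OF X] safe by (auto simp: seqs_def safe_symbol_def)
  then have "y \<in> seqs A" by (simp add: seqs_def)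
  moreover have "openin (seq_topology A) (seqs A - X)"
    using X by (auto simp: subshift_def closedin_def)
  ultimately obtain n where n: "\<And>z. z \<in> seqs A \<Longrightarrow> \<forall>i<n. z i = y i \<Longrightarrow> z \<notin> X"
    using \<open>y \<notin> X\<close> unfolding openin_seq_topology_iff by blast
  have "(\<lambda>i. if i < m then y i else x i) \<in> X" for m
  proof (induction m)
    case (Suc m)
    have eq: "(\<lambda>i. if i < Suc m then y i else x i) = (\<lambda>i. if i < m then y i else x i)(m := y m)"
      by (auto simp: fun_eq_iff less_Suc_eq)
    show ?case
    proof (cases "y m = x m")
      case True
      then have "(\<lambda>i. if i < m then y i else x i)(m := y m) = (\<lambda>i. if i < m then y i else x i)"
        by (auto simp: fun_eq_iff)
      then show ?thesis using Suc eq by simp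
    next
      case False
      then have "y m = \<gamma>" using y[of m] by blast
      then show ?thesis using Suc safe unfolding eq safe_symbol_def by blast
    qed
  qed (use x in simp)
  then show False
    using n[of "\<lambda>i. if i < n then y i else x i"] subshift_subset_seqs[OF X] by auto
qed

lemma const_safe_symbol_in: "subshift A X \<Longrightarrow> safe_symbol A X \<gamma> \<Longrightarrow> (\<lambda>_. \<gamma>) \<in> X"
  by (metis ex_in_conv safe_masking subshift_def)

lemma frequency_bounds: "0 \<le> frequency w x N" "frequency w x N \<le> 1"
proof -
  have "occurrences w x N \<le> card {..<N}"
    unfolding occurrences_def by (intro card_mono) auto
  then show "frequency w x N \<le> 1" by (auto simp: frequency_def divide_le_eq)
qed (simp add: frequency_def)

lemma liminf_less_limsup_frequency_iff:
  "liminf (\<lambda>N. ereal (frequency w x N)) < limsup (\<lambda>N. ereal (frequency w x N)) \<longleftrightarrow>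
    \<not> convergent (frequency w x)"
    (is "?l < ?u \<longleftrightarrow> _")
proof
  assume less: "?l < ?u"
  show "\<not> convergent (frequency w x)"
  proof
    assume "convergent (frequency w x)"
    then obtain L where "frequency w x \<longlonglongrightarrow> L" unfolding convergent_def by blast
    then have "(\<lambda>N. ereal (frequency w x N)) \<longlonglongrightarrow> ereal L" by simp
    then show False
      using less lim_imp_Liminf lim_imp_Limsup trivial_limit_sequentially by (metis less_irrefl)
  qed
next
  assume not_conv: "\<not> convergent (frequency w x)"
  have le: "?l \<le> ?u" by (intro Liminf_le_Limsup) simp
  moreover have "?l \<noteq> ?u"
  proof
    assume eq: "?l = ?u"
    have "0 \<le> ?u" "?u \<le> 1"
      using frequency_bounds by (auto intro!: le_Limsup Limsup_bounded always_eventually)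
    then obtain L where "?u = ereal L" by (cases ?u) auto
    then have "(\<lambda>N. ereal (frequency w x N)) \<longlonglongrightarrow> ereal L"
      using eq by (intro Liminf_eq_Limsup) auto
    then show False using not_conv by (auto simp: convergent_def)
  qed
  ultimately show "?l < ?u" by simp
qed

lemma quasi_regular_set_eq:
  "quasi_regular_set X = {x \<in> X. \<forall>w\<in>language X. convergent (frequency w x)}"
  by (auto simp: quasi_regular_set_def irregular_set_def liminf_less_limsup_frequency_iff)

text \<open>As one of \<open>u\<close> and \<open>v\<close> is constantly the safe symbol, every
  mixture is a masking of the other one and stays in \<open>X\<close>. If \<open>z\<close> tends to
  infinity, the mixture lies in the lower bound for \<open>B\<close>; otherwise the frequency of
  \<open>a\<close> diverges, and the mixture leaves the upper bound.\<close>

lemma Pi3_hard_between: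
  assumes X: "subshift A X" and safe: "safe_symbol A X \<gamma>" and uv: "u \<in> X" "v \<in> X"
    and masks: "u = (\<lambda>_. \<gamma>) \<or> v = (\<lambda>_. \<gamma>)"
    and freq: "frequency [a] u \<longlonglongrightarrow> \<alpha>" "frequency [a] v \<longlonglongrightarrow> \<beta>" "\<alpha> \<noteq> \<beta>"
    and lower: "{x \<in> X. \<forall>w. (\<lambda>N. frequency w x N - frequency w u N) \<longlonglongrightarrow> 0} \<subseteq> B"
    and upper: "B \<subseteq> quasi_regular_set X"
  shows "Pi3_hard (subtopology (seq_topology A) X) B"
proof (rule Pi3_hard_if_reduces_tendsto_infinity[where F = "mix u v"])
  have mix_X: "mix u v z \<in> X" for z
    using masks
  proof
    assume "u = (\<lambda>_. \<gamma>)"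
    then show ?thesis by (intro safe_masking[OF X safe uv(2)]) (simp add: mix_def)
  next
    assume "v = (\<lambda>_. \<gamma>)"
    then show ?thesis by (intro safe_masking[OF X safe uv(1)]) (simp add: mix_def)
  qed
  show "\<exists>n. \<forall>z'. (\<forall>i<n. z' i = z i) \<longrightarrow> mix u v z' \<in> U"
    if U: "openin (subtopology (seq_topology A) X) U" "mix u v z \<in> U" for U z
  proof -
    obtain n where n: "\<And>y. y \<in> X \<Longrightarrow> \<forall>i<n. y i = mix u v z i \<Longrightarrow> y \<in> U"
      using U unfolding openin_subshift_iff[OF subshift_subset_seqs[OF X]] by blast
    have "mix u v z' \<in> U" if "\<forall>i<n. z' i = z i" for z'
      using that by (intro n mix_X allI impI mix_cong) auto
    then show ?thesis by blast
  qed
  show "mix u v z \<in> B \<longleftrightarrow> filterlim z at_top sequentially" for z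
  proof
    assume "filterlim z at_top sequentially"
    then show "mix u v z \<in> B"
      using lower mix_X[of z] mix_same_frequencies[of z _ u v] by auto
  next
    assume B: "mix u v z \<in> B"
    show "filterlim z at_top sequentially"
    proof (rule ccontr)
      assume "\<not> ?thesis"
      then have div: "\<not> convergent (frequency [a] (mix u v z))"
        by (rule mix_frequency_diverges[OF _ freq])
      \<comment> \<open>Irregularity is tested only on words of the language. A symbol that never
        appears has frequency constantly 0, which converges.\<close>
      have "\<exists>l. appears_at [a] (mix u v z) l"
      proof (rule ccontr)
        assume "\<not> ?thesis"
        then have "frequency [a] (mix u v z) = (\<lambda>_. 0)"
          by (auto simp: fun_eq_iff frequency_def occurrences_def)
        then show False using div by (simp add: convergent_const)
      qed
      then have "[a] \<in> language X"
        using mix_X by (auto simp: language_def)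
      then show False using B upper div by (auto simp: quasi_regular_set_eq)
    qed
  qed
qed

section \<open>Upper bounds in the Borel hierarchy\<close>

lemma frequency_cong:
  assumes "\<And>i. i < N + length w \<Longrightarrow> x i = y i"
  shows "frequency w x N = frequency w y N"
proof -
  have "{l. l < N \<and> appears_at w x l} = {l. l < N \<and> appears_at w y l}"
    using assms by (auto simp: appears_at_def)
  then show ?thesis by (simp add: frequency_def occurrences_def)
qed

text \<open>For each \<open>p\<close> only finitely many coordinates matter. Two times are allowed
  so that the lemma covers the Cauchy condition, with \<open>p\<close> a pair of times, as well as
  convergence to a given limit.\<close>

lemma closedin_eventual_frequency_condition:
  assumes "X \<subseteq> seqs A"
  shows "closedin (subtopology (seq_topology A) X) {x \<in> X. \<forall>p. P p (frequency w x (g p)) (frequency w x (h p))}"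
proof -
  have "closedin (subtopology (seq_topology A) X) {x \<in> X. P p (frequency w x (g p)) (frequency w x (h p))}" for p
  proof (rule closedin_finite_coordinates[OF assms])
    fix x y :: "nat \<Rightarrow> 'a" assume "\<And>i. i < max (g p) (h p) + length w \<Longrightarrow> x i = y i"
    then have "frequency w x (g p) = frequency w y (g p)" "frequency w x (h p) = frequency w y (h p)"
      by (auto intro!: frequency_cong)
    moreover assume "P p (frequency w x (g p)) (frequency w x (h p))"
    ultimately show "P p (frequency w y (g p)) (frequency w y (h p))" by simp
  qed
  then have "closedin (subtopology (seq_topology A) X)
      (\<Inter>p. {x \<in> X. P p (frequency w x (g p)) (frequency w x (h p))})"
    by (intro closedin_INT) auto
  moreover have "(\<Inter>p. {x \<in> X. P p (frequency w x (g p)) (frequency w x (h p))})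
      = {x \<in> X. \<forall>p. P p (frequency w x (g p)) (frequency w x (h p))}"
    by blast
  ultimately show ?thesis by simp
qed

lemma countable_words: "countable A \<Longrightarrow> countable {w. w \<noteq> [] \<and> set w \<subseteq> A}"
  by (rule countable_subset[OF _ countable_lists]) (auto simp: in_lists_conv_set)

lemma generic_points_in_Pi3:
  assumes A: "countable A" "A \<noteq> {}" and X: "X \<subseteq> seqs A"
  shows "generic_points A X \<mu> \<in> borel_Pi (subtopology (seq_topology A) X) 3"
proof -
  let ?I = "{w. w \<noteq> [] \<and> set w \<subseteq> A} \<times> (UNIV :: nat set)"
  let ?c = "\<lambda>w. measure \<mu> (cylinder A w)"
  let ?C = "\<lambda>(w, j) M. {x \<in> X. \<forall>N. M \<le> N \<longrightarrow> \<bar>frequency w x N - ?c w\<bar> \<le> 1 / real (Suc j)}"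
  have "(\<Inter>i\<in>?I. \<Union>M. ?C i M) \<in> borel_Pi (subtopology (seq_topology A) X) 3"
  proof (rule countable_INT_UN_closedin_in_Pi3)
    show "countable ?I" using A by (simp add: countable_words)
    obtain a where "a \<in> A" using A by blast
    then have "([a], 0) \<in> ?I" by simp
    then show "?I \<noteq> {}" by blast
    fix i M assume "i \<in> ?I"
    show "closedin (subtopology (seq_topology A) X) (?C i M)"
      using closedin_eventual_frequency_condition[OF X,
          of "\<lambda>N r s. M \<le> N \<longrightarrow> \<bar>r - ?c (fst i)\<bar> \<le> 1 / real (Suc (snd i))" "fst i" "\<lambda>N. N" "\<lambda>N. N"]
      by (simp only: case_prod_unfold)
  qed
  also have "(\<Inter>i\<in>?I. \<Union>M. ?C i M) = generic_points A X \<mu>"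
  proof -
    have lim: "f \<longlonglongrightarrow> c \<longleftrightarrow> (\<forall>j. \<exists>M. \<forall>N. M \<le> N \<longrightarrow> \<bar>f N - c\<bar> \<le> 1 / real (Suc j))"
      for f :: "nat \<Rightarrow> real" and c
    proof
      assume f: "f \<longlonglongrightarrow> c"
      show "\<forall>j. \<exists>M. \<forall>N. M \<le> N \<longrightarrow> \<bar>f N - c\<bar> \<le> 1 / real (Suc j)"
      proof
        fix j
        obtain M where "\<forall>N\<ge>M. norm (f N - c) < 1 / real (Suc j)"
          using LIMSEQ_D[OF f, of "1 / real (Suc j)"] by auto
        then show "\<exists>M. \<forall>N. M \<le> N \<longrightarrow> \<bar>f N - c\<bar> \<le> 1 / real (Suc j)"
          by (intro exI[of _ M]) (simp add: less_imp_le)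
      qed
    next
      assume j: "\<forall>j. \<exists>M. \<forall>N. M \<le> N \<longrightarrow> \<bar>f N - c\<bar> \<le> 1 / real (Suc j)"
      show "f \<longlonglongrightarrow> c"
      proof (rule LIMSEQ_I)
        fix e :: real assume "0 < e"
        then obtain j where "inverse (real (Suc j)) < e" using reals_Archimedean by blast
        then show "\<exists>no. \<forall>n\<ge>no. norm (f n - c) < e"
          using j[rule_format, of j] by (fastforce simp: inverse_eq_divide)
      qed
    qed
    obtain a where "a \<in> A" using A by blast
    then have "x \<in> X" if "x \<in> (\<Inter>i\<in>?I. \<Union>M. ?C i M)" for x
      using INT_D[OF that, of "([a], 0)"] by auto
    then show ?thesis
      unfolding generic_points_def lim by auto
  qed
  finally show ?thesis .
qed

lemma language_nonempty: "X \<noteq> {} \<Longrightarrow> language X \<noteq> {}"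
proof -
  assume "X \<noteq> {}"
  then obtain x where "x \<in> X" by blast
  then have "[x 0] \<in> language X"
    by (auto simp: language_def appears_at_def intro!: bexI[of _ x] exI[of _ 0])
  then show ?thesis by blast
qed

lemma language_subset_words:
  assumes "X \<subseteq> seqs A"
  shows "language X \<subseteq> {w. w \<noteq> [] \<and> set w \<subseteq> A}"
proof
  fix w assume "w \<in> language X"
  then obtain x l where w: "w \<noteq> []" "x \<in> X" "\<And>i. i < length w \<Longrightarrow> x (l + i) = w ! i"
    by (auto simp: language_def appears_at_def)
  have "w ! i \<in> A" if "i < length w" for i
  proof -
    have "x \<in> seqs A" using w(2) assms by blast
    then show ?thesis using w(3)[OF that, symmetric] by (simp add: seqs_def)
  qed
  then show "w \<in> {w. w \<noteq> [] \<and> set w \<subseteq> A}"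
    using w(1) by (auto simp: in_set_conv_nth)
qed

text \<open>No limit is prescribed here, unlike for generic points, so convergence is written as the
  Cauchy condition, which quantifies over times and tolerances only.\<close>

lemma quasi_regular_set_in_Pi3:
  assumes A: "countable A" and X: "X \<subseteq> seqs A" "X \<noteq> {}"
  shows "quasi_regular_set X \<in> borel_Pi (subtopology (seq_topology A) X) 3"
proof -
  let ?I = "language X \<times> (UNIV :: nat set)"
  let ?C = "\<lambda>(w, j) M. {x \<in> X. \<forall>p. M \<le> fst p \<and> M \<le> snd p \<longrightarrow>
      \<bar>frequency w x (fst p) - frequency w x (snd p)\<bar> \<le> 1 / real (Suc j)}"
  have "(\<Inter>i\<in>?I. \<Union>M. ?C i M) \<in> borel_Pi (subtopology (seq_topology A) X) 3"
  proof (rule countable_INT_UN_closedin_in_Pi3)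
    show "countable ?I"
      using countable_subset[OF language_subset_words[OF X(1)] countable_words[OF A]] by simp
    show "?I \<noteq> {}" using language_nonempty[OF X(2)] by simp
    fix i M assume "i \<in> ?I"
    show "closedin (subtopology (seq_topology A) X) (?C i M)"
      using closedin_eventual_frequency_condition[OF X(1),
          of "\<lambda>p r s. M \<le> fst p \<and> M \<le> snd p \<longrightarrow> \<bar>r - s\<bar> \<le> 1 / real (Suc (snd i))" "fst i" fst snd]
      by (simp only: case_prod_unfold)
  qed
  also have "(\<Inter>i\<in>?I. \<Union>M. ?C i M) = quasi_regular_set X"
  proof -
    have conv: "convergent f \<longleftrightarrow>
        (\<forall>j. \<exists>M. \<forall>p. M \<le> fst p \<and> M \<le> snd p \<longrightarrow> \<bar>f (fst p) - f (snd p)\<bar> \<le> 1 / real (Suc j))"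
      for f :: "nat \<Rightarrow> real"
    proof
      assume "convergent f"
      then have f: "Cauchy f" by (simp add: Cauchy_convergent_iff)
      show "\<forall>j. \<exists>M. \<forall>p. M \<le> fst p \<and> M \<le> snd p \<longrightarrow> \<bar>f (fst p) - f (snd p)\<bar> \<le> 1 / real (Suc j)"
      proof
        fix j
        obtain M where "\<forall>m\<ge>M. \<forall>n\<ge>M. norm (f m - f n) < 1 / real (Suc j)"
          using CauchyD[OF f, of "1 / real (Suc j)"] by auto
        then show "\<exists>M. \<forall>p. M \<le> fst p \<and> M \<le> snd p \<longrightarrow> \<bar>f (fst p) - f (snd p)\<bar> \<le> 1 / real (Suc j)"
          by (intro exI[of _ M]) (simp add: less_imp_le)
      qed
    next
      assume j: "\<forall>j. \<exists>M. \<forall>p. M \<le> fst p \<and> M \<le> snd p \<longrightarrow> \<bar>f (fst p) - f (snd p)\<bar> \<le> 1 / real (Suc j)"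
      have "Cauchy f"
      proof (rule CauchyI)
        fix e :: real assume "0 < e"
        then obtain j' where "inverse (real (Suc j')) < e" using reals_Archimedean by blast
        then show "\<exists>M. \<forall>m\<ge>M. \<forall>n\<ge>M. norm (f m - f n) < e"
          using j[rule_format, of j'] by (fastforce simp: inverse_eq_divide)
      qed
      then show "convergent f" by (simp add: Cauchy_convergent_iff)
    qed
    obtain w where "w \<in> language X" using language_nonempty[OF X(2)] by blast
    then have "x \<in> X" if "x \<in> (\<Inter>i\<in>?I. \<Union>M. ?C i M)" for x
      using INT_D[OF that, of "(w, 0)"] by auto
    then show ?thesis
      unfolding quasi_regular_set_eq conv by auto
  qed
  finally show ?thesis .
qed

lemma Sigma3_complete_complement:
  assumes "Pi3_complete T (topspace T - S)" "S \<subseteq> topspace T"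
  shows "Sigma3_complete T S"
proof -
  have compl: "topspace T - (topspace T - R) = R" if "R \<subseteq> topspace T" for R
    using that by blast
  obtain R where R: "R \<in> borel_Sigma T 3" "topspace T - S = topspace T - R"
    using assms(1) by (auto simp: Pi3_complete_def borel_Pi_def)
  then have "S = R"
    using compl[OF assms(2)] compl[OF borel_Sigma_subset_topspace[OF R(1)]] by metis
  moreover have "S \<notin> borel_Pi T 3"
  proof
    assume "S \<in> borel_Pi T 3"
    then obtain Q where Q: "Q \<in> borel_Sigma T 3" "S = topspace T - Q"
      by (auto simp: borel_Pi_def)
    then have "topspace T - S = Q"
      using compl[OF borel_Sigma_subset_topspace[OF Q(1)]] by simp
    then show False using assms(1) Q(1) by (simp add: Pi3_complete_def)
  qed
  ultimately show ?thesis using R(1) by (simp add: Sigma3_complete_def)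
qed

subsection \<open>Invariant measures on sequences\<close>

lemma seqs_generator: "{U. openin (seq_topology A) U} \<subseteq> Pow (seqs A)"
  using openin_subset[of "seq_topology A"] by auto

lemma space_seq_borel [simp]: "space (seq_borel A) = seqs A"
  unfolding seq_borel_def by (rule space_measure_of[OF seqs_generator])

lemma open_in_seq_borel: "openin (seq_topology A) U \<Longrightarrow> U \<in> sets (seq_borel A)"
  unfolding seq_borel_def by (subst sets_measure_of[OF seqs_generator]) auto

lemma cylinder_in_seq_borel [measurable]: "cylinder A w \<in> sets (seq_borel A)"
proof (rule open_in_seq_borel, unfold openin_seq_topology_iff, intro conjI ballI)
  show "cylinder A w \<subseteq> seqs A" by (auto simp: cylinder_def)
  show "\<exists>n. \<forall>y\<in>seqs A. (\<forall>i<n. y i = x i) \<longrightarrow> y \<in> cylinder A w" if "x \<in> cylinder A w" for x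
    using that by (intro exI[of _ "length w"]) (simp add: cylinder_def)
qed

lemma subshift_in_seq_borel:
  assumes "subshift A X"
  shows "X \<in> sets (seq_borel A)"
proof -
  have "seqs A - X \<in> sets (seq_borel A)"
    using assms by (intro open_in_seq_borel) (auto simp: subshift_def closedin_def)
  then have "space (seq_borel A) - (seqs A - X) \<in> sets (seq_borel A)" by (rule sets.compl_sets)
  moreover have "space (seq_borel A) - (seqs A - X) = X"
    using subshift_subset_seqs[OF assms] by auto
  ultimately show ?thesis by simp
qed

lemma shift_in_seqs: "x \<in> seqs A \<Longrightarrow> shift x \<in> seqs A"
  by (simp add: seqs_def shift_def)

lemma measurable_shift: "shift \<in> measurable (seq_borel A) (seq_borel A)"
proof -
  have "shift \<in> measurable (seq_borel A) (sigma (seqs A) {U. openin (seq_topology A) U})"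
  proof (rule measurable_measure_of[OF seqs_generator])
    show "shift \<in> space (seq_borel A) \<rightarrow> seqs A"
      by (auto intro: shift_in_seqs)
    fix U assume "U \<in> {U. openin (seq_topology A) U}"
    then have U: "openin (seq_topology A) U" by simp
    have "openin (seq_topology A) (shift -` U \<inter> seqs A)"
      unfolding openin_seq_topology_iff
    proof (intro conjI ballI)
      fix x assume x: "x \<in> shift -` U \<inter> seqs A"
      then obtain n where n: "\<And>y. y \<in> seqs A \<Longrightarrow> \<forall>i<n. y i = shift x i \<Longrightarrow> y \<in> U"
        using U unfolding openin_seq_topology_iff by blast
      have "y \<in> shift -` U \<inter> seqs A" if "y \<in> seqs A" "\<forall>i<Suc n. y i = x i" for y
        using that n[OF shift_in_seqs[OF that(1)]] by (auto simp: shift_def)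
      then show "\<exists>n. \<forall>y\<in>seqs A. (\<forall>i<n. y i = x i) \<longrightarrow> y \<in> shift -` U \<inter> seqs A" by blast
    qed auto
    then show "shift -` U \<inter> space (seq_borel A) \<in> sets (seq_borel A)"
      using open_in_seq_borel by simp
  qed
  then show ?thesis by (simp only: seq_borel_def[symmetric])
qed

lemma shift_iterate: "(shift ^^ i) x = (\<lambda>n. x (n + i))"
  by (induction i) (auto simp: shift_def fun_eq_iff)

context
  fixes A :: "'a set" and \<mu> :: "(nat \<Rightarrow> 'a) measure"
  assumes \<mu>: "invariant_measure A \<mu>"
begin

lemma invariant_measure_sets: "sets \<mu> = sets (seq_borel A)"
  using \<mu> by (simp add: invariant_measure_def)

lemma invariant_measure_space: "space \<mu> = seqs A"
  using sets_eq_imp_space_eq[OF invariant_measure_sets] by simp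

lemma distr_shift: "distr \<mu> \<mu> shift = \<mu>"
proof (rule measure_eqI)
  interpret prob_space \<mu> using \<mu> by (simp add: invariant_measure_def)
  have meas: "shift \<in> measurable \<mu> \<mu>"
    using measurable_shift[of A] by (simp cong: measurable_cong_sets add: invariant_measure_sets)
  fix S assume S: "S \<in> sets (distr \<mu> \<mu> shift)"
  then have "measure \<mu> S = measure \<mu> (shift -` S \<inter> seqs A)"
    using \<mu> by (simp add: invariant_measure_def)
  then show "emeasure (distr \<mu> \<mu> shift) S = emeasure \<mu> S"
    using S by (simp add: emeasure_distr[OF meas] emeasure_eq_measure invariant_measure_space)
qed simp

lemma unit_observable_cylinder: "unit_observable \<mu> shift (indicator (cylinder A w))"
proof -
  interpret prob_space \<mu> using \<mu> by (simp add: invariant_measure_def)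
  have "cylinder A w \<in> sets \<mu>" unfolding invariant_measure_sets by measurable
  then show ?thesis
    using measurable_shift[of A] distr_shift
    by unfold_locales
      (auto cong: measurable_cong_sets simp: invariant_measure_sets split: split_indicator)
qed

text \<open>The \<open>i\<close>-th shift of \<open>x\<close> lies in the cylinder exactly if
  \<open>w\<close> appears at position \<open>i\<close>, so block frequencies are ergodic
  averages.\<close>

lemma birkhoff_average_cylinder:
  assumes "x \<in> seqs A"
  shows "birkhoff_average shift (indicator (cylinder A w)) N x = frequency w x N"
proof -
  have "indicator (cylinder A w) ((shift ^^ i) x) = (if appears_at w x i then 1 else 0 :: real)" for i
    using assms
    by (auto simp: shift_iterate cylinder_def appears_at_def seqs_def add.commute split: split_indicator)
  then have "(\<Sum>i<N. indicator (cylinder A w) ((shift ^^ i) x)) = real (occurrences w x N)"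
    by (simp add: occurrences_def sum.If_cases lessThan_def Collect_conj_eq)
  then show ?thesis by (simp add: birkhoff_average_def frequency_def)
qed

lemma integral_indicator_cylinder: "(\<integral>x. indicator (cylinder A w) x \<partial>\<mu>) = measure \<mu> (cylinder A w)"
proof -
  have "cylinder A w \<inter> space \<mu> = cylinder A w"
    by (auto simp: cylinder_def invariant_measure_space)
  then show ?thesis by simp
qed

lemma AE_in_subshift:
  assumes "subshift A X" "measure \<mu> X = 1"
  shows "AE x in \<mu>. x \<in> X"
proof -
  interpret prob_space \<mu> using \<mu> by (simp add: invariant_measure_def)
  have "X \<in> sets \<mu>" using subshift_in_seq_borel[OF assms(1)] invariant_measure_sets by simp
  then show ?thesis using prob_eq_1 assms(2) by blast
qed

text \<open>There are only countably many words, so almost every point has the right frequency for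
  all of them at once and lies in \<open>X\<close>.\<close>

lemma ergodic_generic_point_exists:
  assumes erg: "ergodic A \<mu>" and "countable A" "subshift A X" "measure \<mu> X = 1"
  shows "generic_points A X \<mu> \<noteq> {}"
proof -
  interpret prob_space \<mu> using \<mu> by (simp add: invariant_measure_def)
  have "AE x in \<mu>. frequency w x \<longlonglongrightarrow> measure \<mu> (cylinder A w)" for w
  proof -
    interpret unit_observable \<mu> shift "indicator (cylinder A w)"
      by (rule unit_observable_cylinder)
    have "AE x in \<mu>. (\<lambda>N. birkhoff_average shift (indicator (cylinder A w)) N x) \<longlonglongrightarrow>
        (\<integral>x. indicator (cylinder A w) x \<partial>\<mu>)"
      using erg by (intro birkhoff_ergodic)
        (auto simp: ergodic_def invariant_measure_sets invariant_measure_space)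
    then show ?thesis
      using AE_space
      by eventually_elim
        (simp only: birkhoff_average_cylinder invariant_measure_space integral_indicator_cylinder)
  qed
  then have "AE x in \<mu>. \<forall>w\<in>{w. w \<noteq> [] \<and> set w \<subseteq> A}. frequency w x \<longlonglongrightarrow> measure \<mu> (cylinder A w)"
    by (subst AE_ball_countable[OF countable_words]) (use assms in auto)
  with AE_in_subshift[OF assms(3,4)] have "AE x in \<mu>. x \<in> generic_points A X \<mu>"
    by eventually_elim (simp add: generic_points_def)
  then show ?thesis by (auto simp: AE_False)
qed

text \<open>The measure may be non-ergodic, so the limiting frequency depends on the point. Its
  integral is the measure of the cylinder, so it cannot vanish almost everywhere.\<close>

lemma ex_point_with_positive_frequency:
  assumes "subshift A X" "measure \<mu> X = 1" and pos: "measure \<mu> (cylinder A w) > 0"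
  shows "\<exists>y\<in>X. \<exists>c>0. frequency w y \<longlonglongrightarrow> c"
proof (rule ccontr)
  assume no: "\<not> ?thesis"
  interpret unit_observable \<mu> shift "indicator (cylinder A w)"
    by (rule unit_observable_cylinder)
  let ?g = "birkhoff_limsup shift (indicator (cylinder A w))"
  have "AE x in \<mu>. ?g x = 0"
    using birkhoff(1) AE_space AE_in_subshift[OF assms(1,2)]
  proof eventually_elim
    case (elim x)
    then have "frequency w x \<longlonglongrightarrow> ?g x"
      by (simp add: birkhoff_average_cylinder invariant_measure_space)
    then have "\<not> 0 < ?g x" using no elim by blast
    then show ?case using birkhoff_limsup_bounds(1)[of x] by linarith
  qed
  then have "(\<integral>x. ?g x \<partial>\<mu>) = 0" by (rule integral_eq_zero_AE)
  then show False
    using birkhoff(2) pos by (simp only: integral_indicator_cylinder)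
qed

text \<open>By invariance a symbol of measure 0 at coordinate 0 has measure 0 at every coordinate,
  and there are countably many symbols and coordinates.\<close>

lemma AE_const_if_no_other_symbol:
  assumes "countable A" and null: "\<And>a. a \<in> A - {\<gamma>} \<Longrightarrow> measure \<mu> (cylinder A [a]) = 0"
  shows "AE x in \<mu>. x = (\<lambda>_. \<gamma>)"
proof -
  interpret prob_space \<mu> using \<mu> by (simp add: invariant_measure_def)
  have "AE x in \<mu>. x i \<noteq> a" if a: "a \<in> A - {\<gamma>}" for a i
  proof -
    interpret unit_observable \<mu> shift "indicator (cylinder A [a])"
      by (rule unit_observable_cylinder)
    have "cylinder A [a] \<in> sets \<mu>" unfolding invariant_measure_sets by measurable
    then have "AE x in \<mu>. x \<notin> cylinder A [a]"
      using null[OF a] prob_eq_0 by blast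
    then have "AE x in distr \<mu> \<mu> (shift ^^ i). x \<notin> cylinder A [a]"
      by (simp only: distr_iterate)
    then have "AE x in \<mu>. (shift ^^ i) x \<notin> cylinder A [a]"
      by (rule AE_distrD[OF measurable_iterate])
    then show ?thesis
      using AE_space
      by eventually_elim
        (auto simp: cylinder_def shift_iterate invariant_measure_space seqs_def)
  qed
  then have "AE x in \<mu>. \<forall>a\<in>A - {\<gamma>}. x i \<noteq> a" for i
    using assms(1) by (subst AE_ball_countable) auto
  then have "AE x in \<mu>. \<forall>i. \<forall>a\<in>A - {\<gamma>}. x i \<noteq> a"
    by (subst AE_all_countable) auto
  then show ?thesis
    using AE_space
    by eventually_elim (auto simp: invariant_measure_space seqs_def fun_eq_iff)
qed

lemma measure_if_AE_const:
  assumes "AE x in \<mu>. x = c" "S \<in> sets (seq_borel A)"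
  shows "measure \<mu> S = indicator S c"
proof -
  interpret prob_space \<mu> using \<mu> by (simp add: invariant_measure_def)
  have S: "S \<in> sets \<mu>" using assms(2) invariant_measure_sets by simp
  show ?thesis
  proof (cases "c \<in> S")
    case True
    have "AE x in \<mu>. x \<in> S" using assms(1) by eventually_elim (simp add: True)
    then show ?thesis using True prob_eq_1[OF S] by simp
  next
    case False
    have "AE x in \<mu>. x \<notin> S" using assms(1) by eventually_elim (simp add: False)
    then show ?thesis using False prob_eq_0[OF S] by simp
  qed
qed

end

text \<open>Otherwise both measures would be the point mass at the constant sequence of
  \<gamma>.\<close>

lemma ex_other_symbol_charged:
  assumes "countable A" "invariant_measure A \<mu>" "invariant_measure A \<nu>" "\<mu> \<noteq> \<nu>"
  shows "\<exists>a\<in>A - {\<gamma>}. measure \<mu> (cylinder A [a]) > 0 \<or> measure \<nu> (cylinder A [a]) > 0"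
proof (rule ccontr)
  assume "\<not> ?thesis"
  then have null: "measure \<mu> (cylinder A [a]) = 0" "measure \<nu> (cylinder A [a]) = 0"
    if "a \<in> A - {\<gamma>}" for a
    using that zero_less_measure_iff by blast+
  have AE: "AE x in \<mu>. x = (\<lambda>_. \<gamma>)" "AE x in \<nu>. x = (\<lambda>_. \<gamma>)"
    using null by (auto intro!: AE_const_if_no_other_symbol[OF _ assms(1)] assms)
  interpret \<mu>: prob_space \<mu> using assms(2) by (simp add: invariant_measure_def)
  interpret \<nu>: prob_space \<nu> using assms(3) by (simp add: invariant_measure_def)
  have "\<mu> = \<nu>"
  proof (rule measure_eqI)
    show "sets \<mu> = sets \<nu>" using assms invariant_measure_sets by blast
    fix S assume "S \<in> sets \<mu>"
    then have "S \<in> sets (seq_borel A)" using assms invariant_measure_sets by blast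
    then show "emeasure \<mu> S = emeasure \<nu> S"
      using measure_if_AE_const[OF assms(2) AE(1)] measure_if_AE_const[OF assms(3) AE(2)]
      by (simp add: \<mu>.emeasure_eq_measure \<nu>.emeasure_eq_measure)
  qed
  then show False using assms by simp
qed

section \<open>Hardness around the constant sequence and around generic points\<close>

lemma frequency_const:
  "frequency w (\<lambda>_. \<gamma>) \<longlonglongrightarrow> (if \<forall>i<length w. w ! i = \<gamma> then 1 else 0)"
\<comment> \<open>The frequency is constant from \<open>N = 1\<close> on; at \<open>N = 0\<close> it
  is 0 by the convention for division by zero.\<close>
proof (rule tendsto_eventually, rule eventually_sequentiallyI[of 1])
  fix N :: nat assume "1 \<le> N"
  have "appears_at w (\<lambda>_. \<gamma>) l \<longleftrightarrow> (\<forall>i<length w. w ! i = \<gamma>)" for l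
    by (auto simp: appears_at_def)
  then show "frequency w (\<lambda>_. \<gamma>) N = (if \<forall>i<length w. w ! i = \<gamma> then 1 else 0)"
    using \<open>1 \<le> N\<close> by (simp add: frequency_def occurrences_def)
qed

lemma frequency_const_other:
  assumes "a \<noteq> \<gamma>"
  shows "frequency [a] (\<lambda>_. \<gamma>) \<longlonglongrightarrow> 0"
proof -
  have "\<not> (\<forall>i<length [a]. [a] ! i = \<gamma>)" using assms by auto
  then show ?thesis using frequency_const[of "[a]" \<gamma>] by (simp only: if_False)
qed

text \<open>The constant sequence plays the role of \<open>u\<close>. One of the two measures
  charges some \<open>a \<noteq> \<gamma>\<close>, which yields a partner \<open>v\<close> where
  \<open>a\<close> has positive frequency, while in \<open>u\<close> it has frequency 0.\<close>

lemma Pi3_hard_around_const: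
  assumes "countable A" "subshift A X" "safe_symbol A X \<gamma>"
    and "invariant_measure_on A X \<mu>" "invariant_measure_on A X \<nu>" "\<mu> \<noteq> \<nu>"
    and "{x \<in> X. \<forall>w. (\<lambda>N. frequency w x N - frequency w (\<lambda>_. \<gamma>) N) \<longlonglongrightarrow> 0} \<subseteq> B"
    and "B \<subseteq> quasi_regular_set X"
  shows "Pi3_hard (subtopology (seq_topology A) X) B"
proof -
  have inv: "invariant_measure A \<mu>" "invariant_measure A \<nu>" "measure \<mu> X = 1" "measure \<nu> X = 1"
    using assms(4,5) by (simp_all add: invariant_measure_on_def)
  obtain a where a: "a \<in> A - {\<gamma>}" "measure \<mu> (cylinder A [a]) > 0 \<or> measure \<nu> (cylinder A [a]) > 0"
    using ex_other_symbol_charged[OF assms(1) inv(1,2) assms(6), of \<gamma>] by blast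
  obtain y c where y: "y \<in> X" "0 < c" "frequency [a] y \<longlonglongrightarrow> c"
    using a(2) ex_point_with_positive_frequency[OF inv(1) assms(2) inv(3), of "[a]"]
      ex_point_with_positive_frequency[OF inv(2) assms(2) inv(4), of "[a]"] by blast
  show ?thesis
    by (rule Pi3_hard_between[OF assms(2,3) const_safe_symbol_in[OF assms(2,3)] y(1) _
          frequency_const_other y(3) _ assms(7,8)]) (use a y in auto)
qed

lemma Pi3_hard_around_generic_points:
  assumes "countable A" and X: "subshift A X" and safe: "safe_symbol A X \<gamma>"
    and two: "invariant_measure_on A X \<mu>\<^sub>1" "invariant_measure_on A X \<mu>\<^sub>2" "\<mu>\<^sub>1 \<noteq> \<mu>\<^sub>2"
    and \<mu>: "invariant_measure_on A X \<mu>" and nonempty: "generic_points A X \<mu> \<noteq> {}"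
    and lower: "generic_points A X \<mu> \<subseteq> B" and upper: "B \<subseteq> quasi_regular_set X"
  shows "Pi3_hard (subtopology (seq_topology A) X) B"
proof -
  have inv: "invariant_measure A \<mu>" using \<mu> by (simp add: invariant_measure_on_def)
  \<comment> \<open>A sequence in \<open>X\<close> with asymptotically the frequencies of a generic
    point is generic for the same measure.\<close>
  have same: "{x \<in> X. \<forall>w. (\<lambda>N. frequency w x N - frequency w u N) \<longlonglongrightarrow> 0} \<subseteq> B"
    if u: "u \<in> generic_points A X \<mu>" for u
  proof -
    have "frequency w x \<longlonglongrightarrow> measure \<mu> (cylinder A w)"
      if "(\<lambda>N. frequency w x N - frequency w u N) \<longlonglongrightarrow> 0" "w \<noteq> []" "set w \<subseteq> A" for x w
    proof -
      have "frequency w u \<longlonglongrightarrow> measure \<mu> (cylinder A w)"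
        using u that by (simp add: generic_points_def)
      from tendsto_add[OF that(1) this] show ?thesis by simp
    qed
    then show ?thesis using lower by (auto simp: generic_points_def)
  qed
  show ?thesis
  proof (cases "\<exists>a\<in>A - {\<gamma>}. measure \<mu> (cylinder A [a]) \<noteq> 0")
    \<comment> \<open>Here a generic point is masked by the constant sequence: \<open>a\<close> has
      frequency 0 in the latter and nonzero frequency in the former.\<close>
    case True
    then obtain a where a: "a \<in> A" "a \<noteq> \<gamma>" "measure \<mu> (cylinder A [a]) \<noteq> 0" by blast
    obtain u where u: "u \<in> generic_points A X \<mu>" using nonempty by blast
    then have "frequency [a] u \<longlonglongrightarrow> measure \<mu> (cylinder A [a])" "u \<in> X"
      using a by (auto simp: generic_points_def)
    then show ?thesis
      using frequency_const_other[OF a(2)] const_safe_symbol_in[OF X safe] a(3)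
      by (intro Pi3_hard_between[OF X safe _ _ _ _ _ _ same[OF u] upper]) auto
  next
    \<comment> \<open>Here \<mu> is the point mass at the constant sequence, which is therefore
      generic for it; the sequences copied into the windows come from another measure.\<close>
    case False
    then have AE: "AE x in \<mu>. x = (\<lambda>_. \<gamma>)"
      using AE_const_if_no_other_symbol[OF inv assms(1)] by blast
    have "(\<lambda>_. \<gamma>) \<in> generic_points A X \<mu>"
      unfolding generic_points_def
    proof (intro CollectI conjI allI impI)
      show "(\<lambda>_. \<gamma>) \<in> X" by (rule const_safe_symbol_in[OF X safe])
      fix w
      have "(\<lambda>_. \<gamma>) \<in> cylinder A w \<longleftrightarrow> (\<forall>i<length w. w ! i = \<gamma>)"
        using safe by (auto simp: cylinder_def seqs_def safe_symbol_def)
      then have "measure \<mu> (cylinder A w) = (if \<forall>i<length w. w ! i = \<gamma> then 1 else 0)"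
        using measure_if_AE_const[OF inv AE cylinder_in_seq_borel, of w] by (simp add: indicator_def)
      then show "frequency w (\<lambda>_. \<gamma>) \<longlonglongrightarrow> measure \<mu> (cylinder A w)"
        using frequency_const[of w \<gamma>] by simp
    qed
    from Pi3_hard_around_const[OF assms(1) X safe two same[OF this] upper] show ?thesis .
  qed
qed

section \<open>Completeness of the generic, quasi-regular and irregular sets\<close>

lemma generic_points_subset_quasi_regular:
  assumes "X \<subseteq> seqs A"
  shows "generic_points A X \<mu> \<subseteq> quasi_regular_set X"
proof
  fix x assume x: "x \<in> generic_points A X \<mu>"
  have "convergent (frequency w x)" if "w \<in> language X" for w
    using x subsetD[OF language_subset_words[OF assms] that]
    by (auto simp: generic_points_def convergent_def)
  then show "x \<in> quasi_regular_set X"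
    using x by (simp add: quasi_regular_set_eq generic_points_def)
qed

lemma hereditary_safe_symbol:
  assumes "0 \<in> H" "subshift H Y" "hereditary H Y"
  shows "safe_symbol H Y 0"
  unfolding safe_symbol_def
proof (intro conjI ballI allI)
  fix x k assume x: "x \<in> Y"
  then have "x(k := 0) \<in> seqs H"
    using subshift_subset_seqs[OF assms(2)] assms(1) by (auto simp: seqs_def)
  moreover have "\<forall>n. (x(k := 0)) n \<le> x n" by simp
  ultimately show "x(k := 0) \<in> Y"
    using x assms(3) unfolding hereditary_def by blast
qed (rule assms)

theorem theorem10:
  fixes A :: "'a set" and X :: "(nat \<Rightarrow> 'a) set"
  shows
    "(countable A \<and> subshift A X \<and> (\<exists>\<gamma>. safe_symbol A X \<gamma>) \<and>
      (\<exists>\<mu> \<nu>. invariant_measure_on A X \<mu> \<and> invariant_measure_on A X \<nu> \<and> \<mu> \<noteq> \<nu>)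
      \<longrightarrow>
      (\<forall>\<mu> B. invariant_measure_on A X \<mu> \<and> generic_points A X \<mu> \<noteq> {} \<and>
          B \<subseteq> X \<and> B \<in> sets (seq_borel A) \<and>
          generic_points A X \<mu> \<subseteq> B \<and> B \<subseteq> quasi_regular_set X
        \<longrightarrow> Pi3_hard (subtopology (seq_topology A) X) B \<and>
            (B \<in> borel_Pi (subtopology (seq_topology A) X) 3
              \<longrightarrow> Pi3_complete (subtopology (seq_topology A) X) B)) \<and>
      (\<forall>\<mu>. invariant_measure_on A X \<mu>
        \<longrightarrow> generic_points A X \<mu> = {} \<or>
            Pi3_complete (subtopology (seq_topology A) X) (generic_points A X \<mu>)) \<and>
      (\<forall>\<mu>. invariant_measure_on A X \<mu> \<and> ergodic A \<mu>
        \<longrightarrow> Pi3_complete (subtopology (seq_topology A) X) (generic_points A X \<mu>)) \<and>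
      Pi3_complete (subtopology (seq_topology A) X) (quasi_regular_set X) \<and>
      Sigma3_complete (subtopology (seq_topology A) X) (irregular_set X)) \<and>
     (\<forall>(H :: nat set) Y. (H = UNIV \<or> (\<exists>n. H = {0..n})) \<and> subshift H Y \<and> hereditary H Y
        \<longrightarrow> safe_symbol H Y 0)"
proof (rule conjI)
  let ?T = "subtopology (seq_topology A) X"
  show "countable A \<and> subshift A X \<and> (\<exists>\<gamma>. safe_symbol A X \<gamma>) \<and>
      (\<exists>\<mu> \<nu>. invariant_measure_on A X \<mu> \<and> invariant_measure_on A X \<nu> \<and> \<mu> \<noteq> \<nu>)
      \<longrightarrow>
      (\<forall>\<mu> B. invariant_measure_on A X \<mu> \<and> generic_points A X \<mu> \<noteq> {} \<and>
          B \<subseteq> X \<and> B \<in> sets (seq_borel A) \<and>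
          generic_points A X \<mu> \<subseteq> B \<and> B \<subseteq> quasi_regular_set X
        \<longrightarrow> Pi3_hard ?T B \<and> (B \<in> borel_Pi ?T 3 \<longrightarrow> Pi3_complete ?T B)) \<and>
      (\<forall>\<mu>. invariant_measure_on A X \<mu>
        \<longrightarrow> generic_points A X \<mu> = {} \<or> Pi3_complete ?T (generic_points A X \<mu>)) \<and>
      (\<forall>\<mu>. invariant_measure_on A X \<mu> \<and> ergodic A \<mu> \<longrightarrow> Pi3_complete ?T (generic_points A X \<mu>)) \<and>
      Pi3_complete ?T (quasi_regular_set X) \<and> Sigma3_complete ?T (irregular_set X)"
  proof (intro impI, elim conjE exE)
    fix \<gamma> \<mu>\<^sub>1 \<mu>\<^sub>2
    assume A: "countable A" and X: "subshift A X" and safe: "safe_symbol A X \<gamma>"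
      and two: "invariant_measure_on A X \<mu>\<^sub>1" "invariant_measure_on A X \<mu>\<^sub>2" "\<mu>\<^sub>1 \<noteq> \<mu>\<^sub>2"
    have X_sub: "X \<subseteq> seqs A" by (rule subshift_subset_seqs[OF X])
    have X_ne: "X \<noteq> {}" using X by (simp add: subshift_def)
    have A_ne: "A \<noteq> {}" using safe by (auto simp: safe_symbol_def)
    have top: "topspace ?T = X" using X_sub by (simp add: Int_absorb1)
    have complete: "Pi3_complete ?T B" if "Pi3_hard ?T B" "B \<in> borel_Pi ?T 3" for B
      using that by (simp add: Pi3_hard_def Pi3_complete_def)
    note hard = Pi3_hard_around_generic_points[OF A X safe two]
    have generic: "Pi3_complete ?T (generic_points A X \<mu>)"
      if "invariant_measure_on A X \<mu>" "generic_points A X \<mu> \<noteq> {}" for \<mu>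
      by (intro complete hard[OF that] generic_points_in_Pi3 A A_ne X_sub order_refl
          generic_points_subset_quasi_regular)
    \<comment> \<open>For the quasi-regular set the reduction is centred at the constant sequence,
      all of whose frequencies converge, so no measure with a generic point has to be
      exhibited.\<close>
    have const: "{x \<in> X. \<forall>w. (\<lambda>N. frequency w x N - frequency w (\<lambda>_. \<gamma>) N) \<longlonglongrightarrow> 0}
        \<subseteq> quasi_regular_set X"
    proof -
      have "convergent (frequency w x)"
        if "(\<lambda>N. frequency w x N - frequency w (\<lambda>_. \<gamma>) N) \<longlonglongrightarrow> 0" for w x
        using tendsto_add[OF that frequency_const[of w \<gamma>]] by (auto simp: convergent_def)
      then show ?thesis unfolding quasi_regular_set_eq by blast
    qed
    have quasi: "Pi3_complete ?T (quasi_regular_set X)"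
      by (intro complete quasi_regular_set_in_Pi3 A X_sub X_ne order_refl const
          Pi3_hard_around_const[OF A X safe two])
    have irregular: "Sigma3_complete ?T (irregular_set X)"
    proof (rule Sigma3_complete_complement)
      show "Pi3_complete ?T (topspace ?T - irregular_set X)"
        using quasi unfolding top quasi_regular_set_def .
      show "irregular_set X \<subseteq> topspace ?T"
        unfolding top by (auto simp: irregular_set_def)
    qed
    show "(\<forall>\<mu> B. invariant_measure_on A X \<mu> \<and> generic_points A X \<mu> \<noteq> {} \<and>
          B \<subseteq> X \<and> B \<in> sets (seq_borel A) \<and>
          generic_points A X \<mu> \<subseteq> B \<and> B \<subseteq> quasi_regular_set X
        \<longrightarrow> Pi3_hard ?T B \<and> (B \<in> borel_Pi ?T 3 \<longrightarrow> Pi3_complete ?T B)) \<and>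
      (\<forall>\<mu>. invariant_measure_on A X \<mu>
        \<longrightarrow> generic_points A X \<mu> = {} \<or> Pi3_complete ?T (generic_points A X \<mu>)) \<and>
      (\<forall>\<mu>. invariant_measure_on A X \<mu> \<and> ergodic A \<mu> \<longrightarrow> Pi3_complete ?T (generic_points A X \<mu>)) \<and>
      Pi3_complete ?T (quasi_regular_set X) \<and> Sigma3_complete ?T (irregular_set X)"
    proof (intro conjI allI impI quasi irregular; (elim conjE)?)
      fix \<mu> B
      assume B: "invariant_measure_on A X \<mu>" "generic_points A X \<mu> \<noteq> {}"
        "generic_points A X \<mu> \<subseteq> B" "B \<subseteq> quasi_regular_set X"
      show "Pi3_hard ?T B" by (rule hard[OF B])
      then show "Pi3_complete ?T B" if "B \<in> borel_Pi ?T 3"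
        using that by (rule complete)
    next
      fix \<mu> assume "invariant_measure_on A X \<mu>"
      then show "generic_points A X \<mu> = {} \<or> Pi3_complete ?T (generic_points A X \<mu>)"
        using generic by blast
    next
      \<comment> \<open>Ergodicity provides a generic point, which rules out the empty
        alternative.\<close>
      fix \<mu> assume \<mu>: "invariant_measure_on A X \<mu>" "ergodic A \<mu>"
      show "Pi3_complete ?T (generic_points A X \<mu>)"
        using \<mu> ergodic_generic_point_exists[OF _ _ A X]
        by (intro generic) (auto simp: invariant_measure_on_def)
    qed
  qed
  show "\<forall>(H :: nat set) Y. (H = UNIV \<or> (\<exists>n. H = {0..n})) \<and> subshift H Y \<and> hereditary H Y
      \<longrightarrow> safe_symbol H Y 0"
    by (auto intro: hereditary_safe_symbol)
qed

end
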